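(* Let $(\mathcal{P},\eta,K)$ be a para-Hermitian manifold with integral foliations $\mathcal{F}_\pm$ of the eigenbundles $T_\pm$ of $K$. Then for all vector fields $X,Y$ the D-bracket is $$[\![X,Y]\!]^D=\rho_+^{-1}[\![\rho_+X,\rho_+Y]\!]_{\mathcal{F}_+}+\rho_-^{-1}[\![\rho_-X,\rho_-Y]\!]_{\mathcal{F}_-},$$ where $[\![\ ,\ ]\!]_{\mathcal{F}_\pm}$ are the Dorfman brackets of $\mathcal{F}_\pm$. If moreover the manifold is flat (the Levi-Civita connection of $\eta$ has vanishing curvature), then in local adapted coordinates $(x^i,\tilde x_i)_{i=1,\dots,n}$ with $T_+=\mathrm{span}\{\partial_i=\partial/\partial x^i\}$, $T_-=\mathrm{span}\{\tilde\partial^i=\partial/\partial\tilde x_i\}$, $\eta(\partial_i,\tilde\partial^j)=\delta_i^j$ and $\eta(\partial_i,\partial_j)=\eta(\tilde\partial^i,\tilde\partial^j)=0$, the D-bracket takes the form $$[\![X,Y]\!]^D=\left(X^I\partial_IY^J-Y^I\partial_IX^J+\eta_{IL}\eta^{KJ}Y^I\partial_KX^L\right)\partial_J .$$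
   Context: An almost para-Hermitian manifold $(\mathcal{P},\eta,K)$ is a $2n$-dimensional manifold with $K\in\mathrm{End}(T\mathcal{P})$, $K^2=\mathbb{1}$, whose $\pm1$-eigenbundles $T_\pm$ have the same rank, and a pseudo-Riemannian metric $\eta$ with $\eta(K\cdot,K\cdot)=-\eta$. Then $T\mathcal{P}=T_+\oplus T_-$ and $T_\pm$ are maximally isotropic. It is para-Hermitian if both $T_\pm$ are Frobenius integrable. Write $X=x_++x_-$ with $x_\pm\in T_\pm$. The isomorphisms $\rho_\pm:T\mathcal{P}\to T_\pm\oplus T_\pm^*$ are $\rho_\pm(X)=x_\pm+\eta(x_\mp,\cdot)$, and $T_\pm\oplus T_\pm^*=(T\oplus T^* )\mathcal{F}_\pm$. The Dorfman bracket of $\mathcal{F}_\pm$ is $[\![x+\alpha,y+\beta]\!]_{\mathcal{F}_\pm}=[x,y]+\mathcal{L}^\pm_x\beta-\mathcal{L}^\pm_y\alpha+d_\pm(\alpha(y))$ for $x,y\in\Gamma(T_\pm)$, $\alpha,\beta\in\Gamma(T_\pm^* )$, with $d_\pm$ the leafwise (Lie algebroid) differential of $T_\pm$ and $\mathcal{L}^\pm_x=d_\pm\imath_x+\imath_xd_\pm$. Adapted connection: a connection $\nabla$ on $T\mathcal{P}$ with torsion $T^\nabla$ such that (1) $\nabla_{x_+}\eta=0$; (2) $\nabla_{x_+}y_-\in\Gamma(T_-)$; (3) $\eta(T^\nabla(x_+,y_+),z_-)=0$; (4) $\eta(T^\nabla(x_+,y_+),z_+)+\eta(\nabla_{z_+}x_+,y_+)=0$,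 for all sections $x_+,y_+,z_+$ of $T_+$ and $y_-,z_-$ of $T_-$, and such that (1)–(4) also hold with the roles of $T_+,T_-$ exchanged. The D-bracket is defined by $\eta([\![X,Y]\!]^D,Z)=\eta(\nabla_XY-\nabla_YX,Z)+\eta(\nabla_ZX,Y)$ for an adapted connection $\nabla$. Capital indices run over all $2n$ coordinates: $X=X^I\partial_I=X^i\partial_i+\tilde X_i\tilde\partial^i$, $\eta_{IJ}$ are the (constant) components of $\eta$ in the frame $(\partial_I)$ and $\eta^{IJ}$ is the inverse matrix; repeated indices are summed. *)

theory Defs
  imports "HOL-Analysis.Analysis" "HOL-Library.Function_Algebras"
begin

primrec Ck_on :: "nat \<Rightarrow> 'a::euclidean_space set \<Rightarrow> ('a \<Rightarrow> 'b::real_normed_vector) \<Rightarrow> bool" where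
  "Ck_on 0 S f \<longleftrightarrow> continuous_on S f"
| "Ck_on (Suc k) S f \<longleftrightarrow>
     f differentiable_on S \<and> (\<forall>b\<in>Basis. Ck_on k S (\<lambda>x. frechet_derivative f (at x) b))"

text \<open>Only used for open \<open>S\<close>.\<close>
definition smooth_on :: "'a::euclidean_space set \<Rightarrow> ('a \<Rightarrow> 'b::real_normed_vector) \<Rightarrow> bool" where
  "smooth_on S f \<longleftrightarrow> (\<forall>k. Ck_on k S f)"

text \<open>
  The points of the manifold are all points of the (Hausdorff, second countable) type \<open>'p\<close>.
  The index type \<open>'m\<close> gives the dimension \<open>CARD('m)\<close>. An atlas is not required to be maximal;
  the charts of the maximal atlas it generates are those satisfying \<open>smooth_chart\<close>.
\<close>

type_synonym ('p, 'm) chart = "'p set \<times> ('p \<Rightarrow> real ^ 'm)"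

definition is_chart :: "('p::topological_space, 'm::finite) chart \<Rightarrow> bool" where
  "is_chart = (\<lambda>(U, \<phi>). open U \<and> open (\<phi> ` U) \<and> homeomorphism U (\<phi> ` U) \<phi> (inv_into U \<phi>))"

definition smooth_transition :: "('p, 'm::finite) chart \<Rightarrow> ('p, 'm) chart \<Rightarrow> bool" where
  "smooth_transition = (\<lambda>(U, \<phi>) (V, \<psi>). smooth_on (\<phi> ` (U \<inter> V)) (\<psi> \<circ> inv_into U \<phi>))"

definition smooth_manifold ::
    "('p::{t2_space, second_countable_topology}, 'm::finite) chart set \<Rightarrow> bool" where
  "smooth_manifold A \<longleftrightarrow>
     (\<forall>c\<in>A. is_chart c) \<and> (\<Union>c\<in>A. fst c) = UNIV \<and> (\<forall>c\<in>A. \<forall>d\<in>A. smooth_transition c d)"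

definition smooth_chart ::
    "('p::topological_space, 'm::finite) chart set \<Rightarrow> ('p, 'm) chart \<Rightarrow> bool" where
  "smooth_chart A c \<longleftrightarrow>
     is_chart c \<and> (\<forall>d\<in>A. smooth_transition c d \<and> smooth_transition d c)"

definition smooth_functions :: "('p, 'm::finite) chart set \<Rightarrow> ('p \<Rightarrow> real) set" where
  "smooth_functions A = {f. \<forall>(U, \<phi>)\<in>A. smooth_on (\<phi> ` U) (f \<circ> inv_into U \<phi>)}"

text \<open>
  A tangent vector at \<open>p\<close> is a derivation at \<open>p\<close> of the algebra of smooth functions. Since HOL
  functions are total, it is extended by \<open>0\<close> to nonsmooth functions, so that equality of tangent
  vectors is equality of functions. Sums and differences of tangent vectors, of vector fields and
  of real functions are the pointwise ones of \<open>Function_Algebras\<close>.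
\<close>

type_synonym 'p tangent = "('p \<Rightarrow> real) \<Rightarrow> real"
type_synonym 'p vfield = "'p \<Rightarrow> 'p tangent"

definition tscale :: "real \<Rightarrow> 'p tangent \<Rightarrow> 'p tangent" where
  "tscale c v = (\<lambda>f. c * v f)"

lemma vector_space_tscale: "vector_space tscale"
  by unfold_locales (auto simp: tscale_def fun_eq_iff algebra_simps)

definition tangent_space :: "('p, 'm::finite) chart set \<Rightarrow> 'p \<Rightarrow> 'p tangent set" where
  "tangent_space A p = {v.
     (\<forall>f\<in>smooth_functions A. \<forall>g\<in>smooth_functions A. \<forall>a b.
        v (\<lambda>q. a * f q + b * g q) = a * v f + b * v g) \<and>
     (\<forall>f\<in>smooth_functions A. \<forall>g\<in>smooth_functions A.
        v (\<lambda>q. f q * g q) = f p * v g + g p * v f) \<and>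
     (\<forall>f. f \<notin> smooth_functions A \<longrightarrow> v f = 0)}"

definition vact :: "'p vfield \<Rightarrow> ('p \<Rightarrow> real) \<Rightarrow> 'p \<Rightarrow> real" where
  "vact X f = (\<lambda>p. X p f)"

definition vector_fields :: "('p, 'm::finite) chart set \<Rightarrow> 'p vfield set" where
  "vector_fields A = {X. (\<forall>p. X p \<in> tangent_space A p) \<and>
     (\<forall>f\<in>smooth_functions A. vact X f \<in> smooth_functions A)}"

definition fscale :: "('p \<Rightarrow> real) \<Rightarrow> 'p vfield \<Rightarrow> 'p vfield" where
  "fscale f X = (\<lambda>p. tscale (f p) (X p))"

definition lie_bracket :: "'p vfield \<Rightarrow> 'p vfield \<Rightarrow> 'p vfield" where
  "lie_bracket X Y = (\<lambda>p f. X p (vact Y f) - Y p (vact X f))"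

type_synonym 'p metric = "'p \<Rightarrow> 'p tangent \<Rightarrow> 'p tangent \<Rightarrow> real"

definition pair :: "'p metric \<Rightarrow> 'p vfield \<Rightarrow> 'p vfield \<Rightarrow> 'p \<Rightarrow> real" where
  "pair \<eta> X Y = (\<lambda>p. \<eta> p (X p) (Y p))"

definition pseudo_riemannian :: "('p, 'm::finite) chart set \<Rightarrow> 'p metric \<Rightarrow> bool" where
  "pseudo_riemannian A \<eta> \<longleftrightarrow>
     (\<forall>p. \<forall>u\<in>tangent_space A p. \<forall>v\<in>tangent_space A p. \<forall>w\<in>tangent_space A p. \<forall>a b.
        \<eta> p (tscale a u + tscale b v) w = a * \<eta> p u w + b * \<eta> p v w) \<and>
     (\<forall>p. \<forall>v\<in>tangent_space A p. \<forall>w\<in>tangent_space A p. \<eta> p v w = \<eta> p w v) \<and>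
     (\<forall>p. \<forall>v\<in>tangent_space A p. (\<forall>w\<in>tangent_space A p. \<eta> p v w = 0) \<longrightarrow> v = 0) \<and>
     (\<forall>X\<in>vector_fields A. \<forall>Y\<in>vector_fields A. pair \<eta> X Y \<in> smooth_functions A)"

text \<open>\<open>D X Y\<close> stands for \<open>\<nabla>\<^sub>X Y\<close>; only its values on vector fields matter.\<close>

type_synonym 'p conn = "'p vfield \<Rightarrow> 'p vfield \<Rightarrow> 'p vfield"

definition connection :: "('p, 'm::finite) chart set \<Rightarrow> 'p conn \<Rightarrow> bool" where
  "connection A D \<longleftrightarrow>
     (\<forall>X\<in>vector_fields A. \<forall>Y\<in>vector_fields A. D X Y \<in> vector_fields A) \<and>
     (\<forall>X\<in>vector_fields A. \<forall>Y\<in>vector_fields A. \<forall>Z\<in>vector_fields A.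
        D (X + Y) Z = D X Z + D Y Z \<and> D X (Y + Z) = D X Y + D X Z) \<and>
     (\<forall>f\<in>smooth_functions A. \<forall>X\<in>vector_fields A. \<forall>Y\<in>vector_fields A.
        D (fscale f X) Y = fscale f (D X Y) \<and>
        D X (fscale f Y) = fscale (vact X f) Y + fscale f (D X Y))"

definition torsion :: "'p conn \<Rightarrow> 'p vfield \<Rightarrow> 'p vfield \<Rightarrow> 'p vfield" where
  "torsion D X Y = D X Y - D Y X - lie_bracket X Y"

definition curvature :: "'p conn \<Rightarrow> 'p vfield \<Rightarrow> 'p vfield \<Rightarrow> 'p vfield \<Rightarrow> 'p vfield" where
  "curvature D X Y Z = D X (D Y Z) - D Y (D X Z) - D (lie_bracket X Y) Z"

text \<open>\<open>cov_metric \<eta> D X Y Z\<close> is \<open>(\<nabla>\<^sub>X \<eta>)(Y, Z)\<close>.\<close>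
definition cov_metric ::
    "'p metric \<Rightarrow> 'p conn \<Rightarrow> 'p vfield \<Rightarrow> 'p vfield \<Rightarrow> 'p vfield \<Rightarrow> 'p \<Rightarrow> real" where
  "cov_metric \<eta> D X Y Z = vact X (pair \<eta> Y Z) - pair \<eta> (D X Y) Z - pair \<eta> Y (D X Z)"

definition levi_civita :: "('p, 'm::finite) chart set \<Rightarrow> 'p metric \<Rightarrow> 'p conn \<Rightarrow> bool" where
  "levi_civita A \<eta> D \<longleftrightarrow> connection A D \<and>
     (\<forall>X\<in>vector_fields A. \<forall>Y\<in>vector_fields A. torsion D X Y = 0) \<and>
     (\<forall>X\<in>vector_fields A. \<forall>Y\<in>vector_fields A. \<forall>Z\<in>vector_fields A. cov_metric \<eta> D X Y Z = 0)"

definition flat_metric :: "('p, 'm::finite) chart set \<Rightarrow> 'p metric \<Rightarrow> bool" where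
  "flat_metric A \<eta> \<longleftrightarrow> (\<exists>D. levi_civita A \<eta> D \<and>
     (\<forall>X\<in>vector_fields A. \<forall>Y\<in>vector_fields A. \<forall>Z\<in>vector_fields A. curvature D X Y Z = 0))"

text \<open>
  A sign \<open>s \<in> {1, -1}\<close> is used throughout to treat \<open>T\<^sub>+\<close> and \<open>T\<^sub>-\<close> simultaneously:
  \<open>eigenbundle A K 1\<close> is \<open>T\<^sub>+\<close> and \<open>eigenbundle A K (-1)\<close> is \<open>T\<^sub>-\<close>.
\<close>

type_synonym 'p endo = "'p \<Rightarrow> 'p tangent \<Rightarrow> 'p tangent"

definition endomorphism :: "('p, 'm::finite) chart set \<Rightarrow> 'p endo \<Rightarrow> bool" where
  "endomorphism A K \<longleftrightarrow>
     (\<forall>p. \<forall>v\<in>tangent_space A p. K p v \<in> tangent_space A p) \<and>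
     (\<forall>p. \<forall>v\<in>tangent_space A p. \<forall>w\<in>tangent_space A p. \<forall>a b.
        K p (tscale a v + tscale b w) = tscale a (K p v) + tscale b (K p w)) \<and>
     (\<forall>X\<in>vector_fields A. (\<lambda>p. K p (X p)) \<in> vector_fields A)"

definition eigenbundle ::
    "('p, 'm::finite) chart set \<Rightarrow> 'p endo \<Rightarrow> real \<Rightarrow> 'p \<Rightarrow> 'p tangent set" where
  "eigenbundle A K s p = {v \<in> tangent_space A p. K p v = tscale s v}"

definition eigensections ::
    "('p, 'm::finite) chart set \<Rightarrow> 'p endo \<Rightarrow> real \<Rightarrow> 'p vfield set" where
  "eigensections A K s = {X \<in> vector_fields A. \<forall>p. X p \<in> eigenbundle A K s p}"

definition almost_para_hermitian ::
    "('p::{t2_space, second_countable_topology}, 'n::finite + 'n) chart set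
      \<Rightarrow> 'p metric \<Rightarrow> 'p endo \<Rightarrow> bool" where
  "almost_para_hermitian A \<eta> K \<longleftrightarrow>
     smooth_manifold A \<and> pseudo_riemannian A \<eta> \<and> endomorphism A K \<and>
     (\<forall>p. \<forall>v\<in>tangent_space A p. K p (K p v) = v) \<and>
     (\<forall>p. vector_space.dim tscale (eigenbundle A K 1 p) =
          vector_space.dim tscale (eigenbundle A K (-1) p)) \<and>
     (\<forall>p. \<forall>v\<in>tangent_space A p. \<forall>w\<in>tangent_space A p. \<eta> p (K p v) (K p w) = - \<eta> p v w)"

definition frobenius_integrable ::
    "('p, 'm::finite) chart set \<Rightarrow> 'p endo \<Rightarrow> real \<Rightarrow> bool" where
  "frobenius_integrable A K s \<longleftrightarrow>
     (\<forall>X\<in>eigensections A K s. \<forall>Y\<in>eigensections A K s. lie_bracket X Y \<in> eigensections A K s)"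

definition para_hermitian ::
    "('p::{t2_space, second_countable_topology}, 'n::finite + 'n) chart set
      \<Rightarrow> 'p metric \<Rightarrow> 'p endo \<Rightarrow> bool" where
  "para_hermitian A \<eta> K \<longleftrightarrow>
     almost_para_hermitian A \<eta> K \<and> frobenius_integrable A K 1 \<and> frobenius_integrable A K (-1)"

text \<open>The component \<open>x\<^sub>\<plusminus> = (X \<plusminus> K X) / 2\<close> of \<open>X\<close> in \<open>T\<^sub>\<plusminus>\<close>.\<close>
definition eigencomponent :: "'p endo \<Rightarrow> real \<Rightarrow> 'p vfield \<Rightarrow> 'p vfield" where
  "eigencomponent K s X = (\<lambda>p. tscale (1 / 2) (X p + tscale s (K p (X p))))"

text \<open>
  As usual for Lie algebroids, sections of \<open>T\<^sub>\<plusminus>\<^sup>*\<close> and \<open>2\<close>-forms on \<open>T\<^sub>\<plusminus>\<close> are given by their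
  values on sections of \<open>T\<^sub>\<plusminus>\<close>; they are set to \<open>0\<close> on all other arguments.
\<close>

type_synonym 'p form1 = "'p vfield \<Rightarrow> 'p \<Rightarrow> real"
type_synonym 'p form2 = "'p vfield \<Rightarrow> 'p vfield \<Rightarrow> 'p \<Rightarrow> real"

definition d_fun :: "('p, 'm::finite) chart set \<Rightarrow> 'p endo \<Rightarrow> real \<Rightarrow> ('p \<Rightarrow> real) \<Rightarrow> 'p form1" where
  "d_fun A K s f = (\<lambda>z. if z \<in> eigensections A K s then vact z f else 0)"

definition d_form :: "('p, 'm::finite) chart set \<Rightarrow> 'p endo \<Rightarrow> real \<Rightarrow> 'p form1 \<Rightarrow> 'p form2" where
  "d_form A K s \<alpha> = (\<lambda>y z. if y \<in> eigensections A K s \<and> z \<in> eigensections A K s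
     then vact y (\<alpha> z) - vact z (\<alpha> y) - \<alpha> (lie_bracket y z) else 0)"

text \<open>Cartan's formula \<open>\<L>\<^sub>x \<beta> = d (\<iota>\<^sub>x \<beta>) + \<iota>\<^sub>x (d \<beta>)\<close>.\<close>
definition lie_form ::
    "('p, 'm::finite) chart set \<Rightarrow> 'p endo \<Rightarrow> real \<Rightarrow> 'p vfield \<Rightarrow> 'p form1 \<Rightarrow> 'p form1" where
  "lie_form A K s x \<beta> = d_fun A K s (\<beta> x) + d_form A K s \<beta> x"

definition dorfman ::
    "('p, 'm::finite) chart set \<Rightarrow> 'p endo \<Rightarrow> real
      \<Rightarrow> 'p vfield \<times> 'p form1 \<Rightarrow> 'p vfield \<times> 'p form1 \<Rightarrow> 'p vfield \<times> 'p form1" where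
  "dorfman A K s = (\<lambda>(x, \<alpha>) (y, \<beta>).
     (lie_bracket x y, lie_form A K s x \<beta> - lie_form A K s y \<alpha> + d_fun A K s (\<alpha> y)))"

definition rho ::
    "('p, 'm::finite) chart set \<Rightarrow> 'p metric \<Rightarrow> 'p endo \<Rightarrow> real
      \<Rightarrow> 'p vfield \<Rightarrow> 'p vfield \<times> 'p form1" where
  "rho A \<eta> K s X = (eigencomponent K s X,
     \<lambda>z. if z \<in> eigensections A K s then pair \<eta> (eigencomponent K (-s) X) z else 0)"

definition rho_inv ::
    "('p, 'm::finite) chart set \<Rightarrow> 'p metric \<Rightarrow> 'p endo \<Rightarrow> real
      \<Rightarrow> 'p vfield \<times> 'p form1 \<Rightarrow> 'p vfield" where
  "rho_inv A \<eta> K s = the_inv_into (vector_fields A) (rho A \<eta> K s)"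

definition adapted_connection ::
    "('p, 'm::finite) chart set \<Rightarrow> 'p metric \<Rightarrow> 'p endo \<Rightarrow> 'p conn \<Rightarrow> bool" where
  "adapted_connection A \<eta> K D \<longleftrightarrow> connection A D \<and>
     (\<forall>s\<in>{1, -1}.
        (\<forall>x\<in>eigensections A K s. \<forall>Y\<in>vector_fields A. \<forall>Z\<in>vector_fields A.
           cov_metric \<eta> D x Y Z = 0) \<and>
        (\<forall>x\<in>eigensections A K s. \<forall>y\<in>eigensections A K (-s). D x y \<in> eigensections A K (-s)) \<and>
        (\<forall>x\<in>eigensections A K s. \<forall>y\<in>eigensections A K s. \<forall>z\<in>eigensections A K (-s).
           pair \<eta> (torsion D x y) z = 0) \<and>
        (\<forall>x\<in>eigensections A K s. \<forall>y\<in>eigensections A K s. \<forall>z\<in>eigensections A K s.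
           pair \<eta> (torsion D x y) z + pair \<eta> (D z x) y = 0))"

text \<open>\<open>B\<close> is the D-bracket of the connection \<open>D\<close>: as \<open>\<eta>\<close> is nondegenerate, the defining identity determines \<open>B\<close>
  on vector fields. Its values on other arguments are irrelevant.\<close>
definition D_bracket ::
    "('p, 'm::finite) chart set \<Rightarrow> 'p metric \<Rightarrow> 'p conn
      \<Rightarrow> ('p vfield \<Rightarrow> 'p vfield \<Rightarrow> 'p vfield) \<Rightarrow> bool" where
  "D_bracket A \<eta> D B \<longleftrightarrow>
     (\<forall>X\<in>vector_fields A. \<forall>Y\<in>vector_fields A. B X Y \<in> vector_fields A \<and>
        (\<forall>Z\<in>vector_fields A.
           pair \<eta> (B X Y) Z = pair \<eta> (D X Y - D Y X) Z + pair \<eta> (D Z X) Y))"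

text \<open>\<open>partial_deriv (U, \<phi>) I f p\<close> is the derivative \<open>\<partial>\<^sub>I f\<close> at \<open>p \<in> U\<close> of a function \<open>f\<close> defined at
  least on \<open>U\<close>.\<close>
definition partial_deriv :: "('p, 'm::finite) chart \<Rightarrow> 'm \<Rightarrow> ('p \<Rightarrow> real) \<Rightarrow> 'p \<Rightarrow> real" where
  "partial_deriv = (\<lambda>(U, \<phi>) I f p.
     frechet_derivative (f \<circ> inv_into U \<phi>) (at (\<phi> p)) (axis I 1))"

definition coord_vector ::
    "('p, 'm::finite) chart set \<Rightarrow> ('p, 'm) chart \<Rightarrow> 'm \<Rightarrow> 'p vfield" where
  "coord_vector A c I p = (\<lambda>f. if f \<in> smooth_functions A then partial_deriv c I f p else 0)"

text \<open>The components \<open>X\<^sup>I(p)\<close> in \<open>X = X\<^sup>I \<partial>\<^sub>I\<close>.\<close>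
definition coord_components ::
    "('p, 'm::finite) chart set \<Rightarrow> ('p, 'm) chart \<Rightarrow> 'p vfield \<Rightarrow> 'p \<Rightarrow> real ^ 'm" where
  "coord_components A c X p =
     (THE a. X p = (\<Sum>I\<in>UNIV. tscale (a $ I) (coord_vector A c I p)))"

definition metric_matrix ::
    "('p, 'm::finite) chart set \<Rightarrow> 'p metric \<Rightarrow> ('p, 'm) chart \<Rightarrow> 'p \<Rightarrow> real ^ 'm ^ 'm" where
  "metric_matrix A \<eta> c p = (\<chi> I J. \<eta> p (coord_vector A c I p) (coord_vector A c J p))"

text \<open>The indices \<open>Inl i\<close> and \<open>Inr i\<close> belong to the coordinates \<open>x\<^sup>i\<close> and \<open>y\<^sub>i\<close> (the tilde coordinates), respectively.\<close>
definition adapted_chart ::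
    "('p::topological_space, 'n::finite + 'n) chart set \<Rightarrow> 'p metric \<Rightarrow> 'p endo
      \<Rightarrow> ('p, 'n + 'n) chart \<Rightarrow> bool" where
  "adapted_chart A \<eta> K c \<longleftrightarrow> smooth_chart A c \<and>
     (\<forall>p\<in>fst c.
        eigenbundle A K 1 p = module.span tscale (range (\<lambda>i. coord_vector A c (Inl i) p)) \<and>
        eigenbundle A K (-1) p = module.span tscale (range (\<lambda>i. coord_vector A c (Inr i) p)) \<and>
        (\<forall>i j. \<eta> p (coord_vector A c (Inl i) p) (coord_vector A c (Inr j) p) = (if i = j then 1 else 0) \<and>
               \<eta> p (coord_vector A c (Inl i) p) (coord_vector A c (Inl j) p) = 0 \<and>
               \<eta> p (coord_vector A c (Inr i) p) (coord_vector A c (Inr j) p) = 0))"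

end

theory Submission
  imports Defs
begin

text \<open>
  At a single point, the conditions on an adapted connection determine
  \<open>\<eta>(\<nabla>\<^sub>XY - \<nabla>\<^sub>YX, z) + \<eta>(\<nabla>\<^sub>zX, Y)\<close> for sections \<open>z\<close> of \<open>T\<^sub>\<plusminus>\<close>: after splitting \<open>X\<close> and \<open>Y\<close> into
  their \<open>T\<^sub>\<plusminus>\<close>-components, every covariant derivative is eliminated in favour of Lie brackets and
  of derivatives of functions \<open>\<eta>(\<cdot>,\<cdot>)\<close>. What remains is the Dorfman bracket of \<open>\<F>\<^sub>\<plusminus>\<close> paired with \<open>z\<close>,
  plus \<open>\<eta>([x\<^sub>\<mp>, y\<^sub>\<mp>], z)\<close>, which yields the first formula. In adapted coordinates the
  componentwise derivative satisfies the same conditions at each point of the chart domain, hence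
  it computes the same bracket, which yields the second formula.

  Both parts need that \<open>\<eta>\<close> can be tested against vector fields, that is, that every
  derivation at a point is a combination of coordinate derivations (Hadamard's lemma) and extends
  to a global vector field (bump functions).
\<close>

section \<open>Calculus of \<open>C\<^sup>k\<close> and smooth functions\<close>

lemma differentiable_on_openD: "open S \<Longrightarrow> f differentiable_on S \<Longrightarrow> x \<in> S \<Longrightarrow> f differentiable at x"
  by (metis at_within_open differentiable_on_def)

lemma Ck_on_cong:
  assumes "open S" "\<And>x. x \<in> S \<Longrightarrow> f x = g x" "Ck_on k S f"
  shows "Ck_on k S g"
  using assms(2,3)
proof (induction k arbitrary: f g)
  case 0
  then show ?case by (simp cong: continuous_on_cong)
next
  case (Suc k)
  have diff: "f differentiable at x" if "x \<in> S" for x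
    using Suc.prems(2) that assms(1) differentiable_on_openD by auto
  have der: "frechet_derivative f (at x) = frechet_derivative g (at x)" if "x \<in> S" for x
    using frechet_derivative_transform_within_open[OF diff[OF that] assms(1) that] Suc.prems(1) by auto
  have "g differentiable_on S"
    using Suc.prems by (auto simp: differentiable_on_def intro: differentiable_transform_within[where d=1])
  moreover have "Ck_on k S (\<lambda>x. frechet_derivative g (at x) b)" if "b \<in> Basis" for b
    by (rule Suc.IH[of "\<lambda>x. frechet_derivative f (at x) b"]) (use Suc.prems der that in auto)
  ultimately show ?case by simp
qed

lemma Ck_on_SucI:
  assumes "open S" "\<And>x. x \<in> S \<Longrightarrow> (f has_derivative f' x) (at x)"
    and "\<And>b. b \<in> Basis \<Longrightarrow> Ck_on k S (\<lambda>x. f' x b)"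
  shows "Ck_on (Suc k) S f"
proof -
  have "f differentiable_on S"
    using assms(2) by (meson differentiable_at_imp_differentiable_on differentiable_def)
  moreover have "Ck_on k S (\<lambda>x. frechet_derivative f (at x) b)" if "b \<in> Basis" for b
    by (rule Ck_on_cong[OF assms(1) _ assms(3)[OF that]])
       (metis assms(2) frechet_derivative_at)
  ultimately show ?thesis by simp
qed

lemma Ck_on_Suc_has_derivative:
  assumes "open S" "Ck_on (Suc k) S f" "x \<in> S"
  shows "(f has_derivative frechet_derivative f (at x)) (at x)"
  using assms differentiable_on_openD[of S f x] by (simp add: frechet_derivative_works)

lemma Ck_on_SucD: "open S \<Longrightarrow> Ck_on (Suc k) S f \<Longrightarrow> Ck_on k S f"
proof (induction k arbitrary: f)
  case 0
  then show ?case by (simp add: differentiable_imp_continuous_on)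
next
  case (Suc k)
  then show ?case by (metis Ck_on.simps(2))
qed

lemma Ck_on_subset: "open S \<Longrightarrow> Ck_on k T f \<Longrightarrow> S \<subseteq> T \<Longrightarrow> Ck_on k S f"
  by (induction k arbitrary: f)
     (auto intro: continuous_on_subset differentiable_on_subset)

lemma Ck_on_local:
  assumes "open S" "\<And>x. x \<in> S \<Longrightarrow> \<exists>T. open T \<and> x \<in> T \<and> Ck_on k T f"
  shows "Ck_on k S f"
  using assms(2)
proof (induction k arbitrary: f)
  case 0
  then show ?case
    by (simp, intro continuous_at_imp_continuous_on) (meson continuous_on_eq_continuous_at)
next
  case (Suc k)
  have "f differentiable at x" if "x \<in> S" for x
    using Suc.prems[OF that] Ck_on_Suc_has_derivative differentiable_def by blast
  then have "f differentiable_on S"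
    by (simp add: differentiable_at_withinI differentiable_on_def)
  moreover have "Ck_on k S (\<lambda>x. frechet_derivative f (at x) b)" if "b \<in> Basis" for b
    using Suc.prems that by (intro Suc.IH) (metis Ck_on.simps(2))
  ultimately show ?case by simp
qed

lemma Ck_on_const: "open S \<Longrightarrow> Ck_on k S (\<lambda>x. c)"
  by (induction k arbitrary: c) auto

lemma Ck_on_linear:
  assumes "open S" "bounded_linear L"
  shows "Ck_on k S L"
proof (cases k)
  case 0
  then show ?thesis by (simp add: assms(2) linear_continuous_on)
next
  case (Suc j)
  have "Ck_on (Suc j) S L"
    by (rule Ck_on_SucI[where f' = "\<lambda>x. L"])
       (use assms in \<open>auto intro: Ck_on_const bounded_linear_imp_has_derivative\<close>)
  then show ?thesis using Suc by simp
qed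

lemma Ck_on_add:
  assumes "open S" "Ck_on k S f" "Ck_on k S g"
  shows "Ck_on k S (\<lambda>x. f x + g x)"
  using assms(2,3)
proof (induction k arbitrary: f g)
  case 0
  then show ?case by (simp add: continuous_on_add)
next
  case (Suc k)
  show ?case
  proof (rule Ck_on_SucI[OF assms(1)])
    show "((\<lambda>x. f x + g x) has_derivative
        (\<lambda>b. frechet_derivative f (at x) b + frechet_derivative g (at x) b)) (at x)" if "x \<in> S" for x
      by (intro has_derivative_add Ck_on_Suc_has_derivative[OF assms(1) _ that]) (use Suc.prems in auto)
  qed (use Suc in auto)
qed

lemma Ck_on_sum:
  "open S \<Longrightarrow> (\<And>i. i \<in> I \<Longrightarrow> Ck_on k S (f i)) \<Longrightarrow> Ck_on k S (\<lambda>x. \<Sum>i\<in>I. f i x)"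
  by (induction I rule: infinite_finite_induct) (auto intro: Ck_on_const Ck_on_add)

lemma Ck_on_scaleR:
  assumes "open S" "Ck_on k S f" "Ck_on k S g"
  shows "Ck_on k S (\<lambda>x. f x *\<^sub>R g x)"
  using assms(2,3)
proof (induction k arbitrary: f g)
  case 0
  then show ?case by (simp add: continuous_on_scaleR)
next
  case (Suc k)
  show ?case
  proof (rule Ck_on_SucI[OF assms(1)])
    show "((\<lambda>x. f x *\<^sub>R g x) has_derivative
        (\<lambda>b. f x *\<^sub>R frechet_derivative g (at x) b + frechet_derivative f (at x) b *\<^sub>R g x)) (at x)"
      if "x \<in> S" for x
      by (intro has_derivative_scaleR Ck_on_Suc_has_derivative[OF assms(1) _ that]) (use Suc.prems in auto)
  next
    fix b :: 'a assume "b \<in> Basis"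
    then show "Ck_on k S (\<lambda>x. f x *\<^sub>R frechet_derivative g (at x) b + frechet_derivative f (at x) b *\<^sub>R g x)"
      using Suc.prems Ck_on_SucD[OF assms(1) Suc.prems(1)] Ck_on_SucD[OF assms(1) Suc.prems(2)]
      by (intro Ck_on_add[OF assms(1)] Suc.IH) auto
  qed
qed

lemma Ck_on_mult:
  fixes f g :: "'a::euclidean_space \<Rightarrow> real"
  shows "open S \<Longrightarrow> Ck_on k S f \<Longrightarrow> Ck_on k S g \<Longrightarrow> Ck_on k S (\<lambda>x. f x * g x)"
  using Ck_on_scaleR[of S k f g] by simp

lemma Ck_on_bounded_linear:
  assumes "open S" "bounded_linear L" "Ck_on k S f"
  shows "Ck_on k S (\<lambda>x. L (f x))"
  using assms(3)
proof (induction k arbitrary: f)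
  case 0
  then show ?case by (simp add: assms(2) bounded_linear.continuous_on)
next
  case (Suc k)
  show ?case
  proof (rule Ck_on_SucI[OF assms(1)])
    show "((\<lambda>x. L (f x)) has_derivative (\<lambda>b. L (frechet_derivative f (at x) b))) (at x)" if "x \<in> S" for x
      using bounded_linear.has_derivative[OF assms(2) Ck_on_Suc_has_derivative[OF assms(1) Suc.prems that]] .
  qed (use Suc in auto)
qed

lemma Ck_on_compose:
  fixes f :: "'b::euclidean_space \<Rightarrow> 'c::real_normed_vector" and g :: "'a::euclidean_space \<Rightarrow> 'b"
  assumes "open S" "open T" "g ` S \<subseteq> T" "Ck_on k S g" "Ck_on k T f"
  shows "Ck_on k S (\<lambda>x. f (g x))"
  using assms(4,5)
proof (induction k arbitrary: f)
  case 0
  then show ?case using assms(3) by (auto intro: continuous_on_compose2)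
next
  case (Suc k)
  show ?case
  proof (rule Ck_on_SucI[OF assms(1)])
    fix x assume x: "x \<in> S"
    then have gx: "g x \<in> T" using assms(3) by auto
    note df = Ck_on_Suc_has_derivative[OF assms(2) Suc.prems(2) gx]
    have "((\<lambda>x. f (g x)) has_derivative
        (\<lambda>b. frechet_derivative f (at (g x)) (frechet_derivative g (at x) b))) (at x)"
      using diff_chain_at[OF Ck_on_Suc_has_derivative[OF assms(1) Suc.prems(1) x] df]
      by (simp add: o_def)
    then show "((\<lambda>x. f (g x)) has_derivative (\<lambda>b. \<Sum>c\<in>Basis.
        (frechet_derivative g (at x) b \<bullet> c) *\<^sub>R frechet_derivative f (at (g x)) c)) (at x)"
    proof (rule has_derivative_eq_rhs, intro ext)
      fix b
      let ?v = "frechet_derivative g (at x) b"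
      have lin: "linear (frechet_derivative f (at (g x)))"
        using df has_derivative_linear by blast
      have "frechet_derivative f (at (g x)) ?v = frechet_derivative f (at (g x)) (\<Sum>c\<in>Basis. (?v \<bullet> c) *\<^sub>R c)"
        by (simp add: euclidean_representation)
      then show "frechet_derivative f (at (g x)) ?v =
          (\<Sum>c\<in>Basis. (?v \<bullet> c) *\<^sub>R frechet_derivative f (at (g x)) c)"
        by (simp add: linear_sum[OF lin] linear_scale[OF lin])
    qed
  next
    fix b :: 'a assume b: "b \<in> Basis"
    show "Ck_on k S (\<lambda>x. \<Sum>c\<in>Basis.
        (frechet_derivative g (at x) b \<bullet> c) *\<^sub>R frechet_derivative f (at (g x)) c)"
      by (intro Ck_on_sum Ck_on_scaleR assms(1) Suc.IH
          Ck_on_bounded_linear[OF assms(1) bounded_linear_inner_left] Ck_on_SucD[OF assms(1) Suc.prems(1)])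
         (use Suc.prems b in auto)
  qed
qed

lemma smooth_on_cong:
  "open S \<Longrightarrow> (\<And>x. x \<in> S \<Longrightarrow> f x = g x) \<Longrightarrow> smooth_on S f \<Longrightarrow> smooth_on S g"
  unfolding smooth_on_def using Ck_on_cong by blast

lemma smooth_on_subset: "open S \<Longrightarrow> smooth_on T f \<Longrightarrow> S \<subseteq> T \<Longrightarrow> smooth_on S f"
  unfolding smooth_on_def using Ck_on_subset by blast

lemma smooth_on_local:
  "open S \<Longrightarrow> (\<And>x. x \<in> S \<Longrightarrow> \<exists>T. open T \<and> x \<in> T \<and> smooth_on T f) \<Longrightarrow> smooth_on S f"
  unfolding smooth_on_def by (meson Ck_on_local)

lemma smooth_on_const: "open S \<Longrightarrow> smooth_on S (\<lambda>x. c)"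
  unfolding smooth_on_def using Ck_on_const by blast

lemma smooth_on_linear: "open S \<Longrightarrow> bounded_linear L \<Longrightarrow> smooth_on S L"
  unfolding smooth_on_def using Ck_on_linear by blast

lemma smooth_on_add: "open S \<Longrightarrow> smooth_on S f \<Longrightarrow> smooth_on S g \<Longrightarrow> smooth_on S (\<lambda>x. f x + g x)"
  unfolding smooth_on_def using Ck_on_add by blast

lemma smooth_on_sum:
  "open S \<Longrightarrow> (\<And>i. i \<in> I \<Longrightarrow> smooth_on S (f i)) \<Longrightarrow> smooth_on S (\<lambda>x. \<Sum>i\<in>I. f i x)"
  unfolding smooth_on_def using Ck_on_sum[of S I] by blast

lemma smooth_on_mult:
  fixes f g :: "'a::euclidean_space \<Rightarrow> real"
  shows "open S \<Longrightarrow> smooth_on S f \<Longrightarrow> smooth_on S g \<Longrightarrow> smooth_on S (\<lambda>x. f x * g x)"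
  unfolding smooth_on_def using Ck_on_mult by blast

lemma smooth_on_compose:
  fixes f :: "'b::euclidean_space \<Rightarrow> 'c::real_normed_vector" and g :: "'a::euclidean_space \<Rightarrow> 'b"
  shows "open S \<Longrightarrow> open T \<Longrightarrow> g ` S \<subseteq> T \<Longrightarrow> smooth_on S g \<Longrightarrow> smooth_on T f \<Longrightarrow> smooth_on S (\<lambda>x. f (g x))"
  unfolding smooth_on_def using Ck_on_compose by blast

lemma smooth_on_frechet_derivative:
  "smooth_on S f \<Longrightarrow> b \<in> Basis \<Longrightarrow> smooth_on S (\<lambda>x. frechet_derivative f (at x) b)"
  unfolding smooth_on_def by (metis Ck_on.simps(2))

lemma smooth_on_has_derivative:
  "open S \<Longrightarrow> smooth_on S f \<Longrightarrow> x \<in> S \<Longrightarrow> (f has_derivative frechet_derivative f (at x)) (at x)"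
  unfolding smooth_on_def using Ck_on_Suc_has_derivative by blast

lemma smooth_on_continuous_on: "smooth_on S f \<Longrightarrow> continuous_on S f"
  unfolding smooth_on_def by (metis Ck_on.simps(1))

section \<open>Bump functions\<close>

text \<open>The family is closed under differentiation, which gives smoothness by induction.\<close>
definition flat_exp :: "nat \<Rightarrow> real \<Rightarrow> real" where
  "flat_exp n t = (if t \<le> 0 then 0 else inverse t ^ n * exp (- inverse t))"

lemma has_derivative_flat_exp:
  "(flat_exp n has_derivative (\<lambda>h. h * (flat_exp (n + 2) t - real n * flat_exp (n + 1) t))) (at t)"
proof -
  consider "t < 0" | "t = 0" | "t > 0" by linarith
  then show ?thesis
  proof cases
    case 1
    have "(flat_exp n has_derivative (\<lambda>h. 0)) (at t)"
      by (rule has_derivative_transform_within_open[of "\<lambda>x. 0" _ _ _ "{..<0}"])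
         (use 1 in \<open>auto simp: flat_exp_def\<close>)
    then show ?thesis using 1 by (simp add: flat_exp_def)
  next
    case 2
    have "((\<lambda>h. flat_exp n h / h) \<longlongrightarrow> 0) (at 0)"
    proof (rule filterlim_split_at)
      show "((\<lambda>h. flat_exp n h / h) \<longlongrightarrow> 0) (at_left 0)"
        by (rule tendsto_eventually)
           (auto simp: flat_exp_def eventually_at_filter)
      have "((\<lambda>h::real. inverse h ^ (n + 1) / exp (inverse h)) \<longlongrightarrow> 0) (at_right 0)"
        by (rule filterlim_compose[OF tendsto_power_div_exp_0 filterlim_inverse_at_top_right])
      then show "((\<lambda>h. flat_exp n h / h) \<longlongrightarrow> 0) (at_right 0)"
        by (rule Lim_transform_eventually)
           (auto simp: eventually_at_filter flat_exp_def exp_minus divide_inverse)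
    qed
    then have "(flat_exp n has_field_derivative 0) (at 0)"
      by (simp add: DERIV_def flat_exp_def)
    then show ?thesis using 2 by (simp add: flat_exp_def has_field_derivative_def lambda_zero)
  next
    case 3
    have "((\<lambda>t. inverse t ^ n * exp (- inverse t)) has_field_derivative
       flat_exp (n + 2) t - real n * flat_exp (n + 1) t) (at t)"
    proof (rule DERIV_cong[OF DERIV_mult[OF DERIV_power[OF DERIV_inverse] DERIV_fun_exp[OF DERIV_minus[OF DERIV_inverse]]]])
      show "real n * (- (inverse t ^ Suc (Suc 0)) * inverse t ^ (n - Suc 0)) * exp (- inverse t) +
          exp (- inverse t) * - (- (inverse t ^ Suc (Suc 0))) * inverse t ^ n =
          flat_exp (n + 2) t - real n * flat_exp (n + 1) t"
        using 3 by (cases n) (simp_all add: flat_exp_def algebra_simps)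
    qed (use 3 in auto)
    then have "((\<lambda>t. inverse t ^ n * exp (- inverse t)) has_derivative
       (\<lambda>h. h * (flat_exp (n + 2) t - real n * flat_exp (n + 1) t))) (at t)"
      by (simp only: has_field_derivative_def mult_commute_abs)
    then show ?thesis
      by (rule has_derivative_transform_within_open[of _ _ _ _ "{0<..}"])
         (use 3 in \<open>auto simp: flat_exp_def\<close>)
  qed
qed

lemma smooth_flat_exp: "smooth_on UNIV (flat_exp n)"
  unfolding smooth_on_def
proof
  fix k
  show "Ck_on k UNIV (flat_exp n)"
  proof (induction k arbitrary: n)
    case 0
    then show ?case
      by (auto intro!: continuous_at_imp_continuous_on has_derivative_continuous[OF has_derivative_flat_exp])
  next
    case (Suc k)
    show ?case
    proof (rule Ck_on_SucI[OF _ has_derivative_flat_exp])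
      fix b :: real assume "b \<in> Basis"
      have "Ck_on k UNIV (\<lambda>x. b * (flat_exp (n + 2) x + (- real n) * flat_exp (n + 1) x))"
        by (intro Ck_on_mult Ck_on_add Suc.IH Ck_on_const) auto
      then show "Ck_on k UNIV (\<lambda>x. b * (flat_exp (n + 2) x - real n * flat_exp (n + 1) x))" by simp
    qed simp
  qed
qed

definition bump :: "'a::euclidean_space \<Rightarrow> real \<Rightarrow> 'a \<Rightarrow> real" where
  "bump a r x = exp (inverse (r\<^sup>2)) * flat_exp 0 (r\<^sup>2 - (\<Sum>b\<in>Basis. ((x - a) \<bullet> b) * ((x - a) \<bullet> b)))"

lemma bump_eq: "bump a r x = exp (inverse (r\<^sup>2)) * flat_exp 0 (r\<^sup>2 - (norm (x - a))\<^sup>2)"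
  unfolding bump_def by (simp add: euclidean_inner[symmetric] power2_norm_eq_inner)

lemma bump_center [simp]: "r > 0 \<Longrightarrow> bump a r a = 1"
  by (simp add: bump_eq flat_exp_def exp_minus_inverse)

lemma bump_outside: "r > 0 \<Longrightarrow> x \<notin> cball a r \<Longrightarrow> bump a r x = 0"
  by (simp add: bump_eq flat_exp_def dist_norm norm_minus_commute power_mono)

lemma bump_pos: "x \<in> ball a r \<Longrightarrow> bump a r x > 0"
  using power_strict_mono[of "norm (x - a)" r 2]
  by (simp add: bump_eq flat_exp_def dist_norm norm_minus_commute)

lemma smooth_on_coordinate: "open S \<Longrightarrow> smooth_on S (\<lambda>x. (x - a) \<bullet> b)"
  using smooth_on_add[OF _ smooth_on_linear[OF _ bounded_linear_inner_left[of b]]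
      smooth_on_const[where c = "- (a \<bullet> b)"]]
  by (simp add: inner_diff_left)

lemma smooth_bump: "smooth_on UNIV (bump a r)"
proof -
  have "smooth_on UNIV (\<lambda>x. exp (inverse (r\<^sup>2)) * flat_exp 0 (r\<^sup>2 + (- 1) * (\<Sum>b\<in>Basis. ((x - a) \<bullet> b) * ((x - a) \<bullet> b))))"
    by (intro smooth_on_mult smooth_on_const smooth_on_compose[OF _ _ _ _ smooth_flat_exp]
        smooth_on_add smooth_on_sum smooth_on_coordinate) auto
  then show ?thesis unfolding bump_def by simp
qed

lemma smooth_bump_mult:
  assumes "r > 0" "open V" "cball a r \<subseteq> V" "smooth_on V G"
  shows "smooth_on UNIV (\<lambda>x. bump a r x * G x)"
proof (rule smooth_on_local)
  fix x
  show "\<exists>T. open T \<and> x \<in> T \<and> smooth_on T (\<lambda>x. bump a r x * G x)"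
  proof (cases "x \<in> V")
    case True
    have "smooth_on V (\<lambda>x. bump a r x * G x)"
      by (intro smooth_on_mult assms smooth_on_subset[OF _ smooth_bump]) auto
    then show ?thesis using True assms by blast
  next
    case False
    have "smooth_on (- cball a r) (\<lambda>x. bump a r x * G x)"
      by (rule smooth_on_cong[OF _ _ smooth_on_const[of _ 0]]) (auto simp: bump_outside assms)
    moreover have "x \<in> - cball a r" using False assms by auto
    ultimately show ?thesis by (meson closed_cball open_Compl)
  qed
qed simp

section \<open>Hadamard's lemma\<close>

lemma dilation_in_ball:
  fixes a x :: "'a::real_normed_vector"
  assumes "x \<in> ball a r" "t \<in> {0..1}"
  shows "a + t *\<^sub>R (x - a) \<in> ball a r"
proof -
  have "\<bar>t\<bar> * norm (x - a) \<le> 1 * norm (x - a)"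
    using assms(2) by (intro mult_right_mono) auto
  then show ?thesis using assms(1) by (simp add: dist_norm norm_minus_commute)
qed

lemma continuous_on_dilation:
  fixes h :: "'a::real_normed_vector \<Rightarrow> 'b::topological_space"
  assumes "continuous_on (ball a r) h"
  shows "continuous_on (ball a r \<times> {0..1}) (\<lambda>(x, t). h (a + t *\<^sub>R (x - a)))"
  unfolding split_beta
  by (rule continuous_on_compose2[OF assms]) (auto intro!: continuous_intros dilation_in_ball)

lemma Ck_on_integral_dilation:
  fixes h :: "'a::euclidean_space \<Rightarrow> real"
  assumes "smooth_on (ball a r) h"
  shows "Ck_on k (ball a r) (\<lambda>x. integral {0..1} (\<lambda>t. t ^ j * h (a + t *\<^sub>R (x - a))))"
  using assms
proof (induction k arbitrary: j h)
  case (0 j h)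
  have "continuous_on (ball a r \<times> {0..1}) (\<lambda>(x, t). t ^ j * h (a + t *\<^sub>R (x - a)))"
    using continuous_on_dilation[OF smooth_on_continuous_on[OF 0]]
    by (auto simp: split_beta intro!: continuous_intros)
  then show ?case
    using integral_continuous_on_param[of "ball a r" 0 1 "\<lambda>x t. t ^ j * h (a + t *\<^sub>R (x - a))"] by simp
next
  case (Suc k j h)
  let ?h' = "\<lambda>b y. frechet_derivative h (at y) b"
  define G where "G x t = (\<Sum>c\<in>Basis. (t ^ Suc j * ?h' c (a + t *\<^sub>R (x - a))) *\<^sub>R blinfun_inner_right c)" for x t
  have smooth_h': "smooth_on (ball a r) (?h' c)" if "c \<in> Basis" for c
    using smooth_on_frechet_derivative[OF Suc.prems that] .
  have G_apply: "blinfun_apply (G x t) b = t ^ Suc j * ?h' b (a + t *\<^sub>R (x - a))"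
    if "x \<in> ball a r" "t \<in> {0..1}" for x t b
  proof -
    have lin: "linear (frechet_derivative h (at (a + t *\<^sub>R (x - a))))"
      using smooth_on_has_derivative[OF open_ball Suc.prems dilation_in_ball[OF that]] has_derivative_linear by auto
    have "?h' b (a + t *\<^sub>R (x - a)) = frechet_derivative h (at (a + t *\<^sub>R (x - a))) (\<Sum>c\<in>Basis. (b \<bullet> c) *\<^sub>R c)"
      by (simp add: euclidean_representation)
    then show ?thesis
      by (simp add: linear_sum[OF lin] linear_scale[OF lin] G_def blinfun.sum_left blinfun.scaleR_left
          sum_distrib_left inner_commute mult_ac)
  qed
  have cont_h': "continuous_on (ball a r \<times> {0..1}) (\<lambda>z. ?h' c (a + snd z *\<^sub>R (fst z - a)))" if "c \<in> Basis" for c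
    using continuous_on_dilation[OF smooth_on_continuous_on[OF smooth_h'[OF that]]]
    by (simp add: split_beta)
  have cont_G: "continuous_on (ball a r \<times> {0..1}) (\<lambda>(x, t). G x t)"
    unfolding G_def split_beta by (intro continuous_intros cont_h')
  have cont_G': "continuous_on {0..1} (G x)" if "x \<in> ball a r" for x
  proof -
    have "continuous_on {0..1} (\<lambda>t. (\<lambda>(x, t). G x t) (x, t))"
      by (rule continuous_on_compose2[OF cont_G]) (use that in \<open>auto intro!: continuous_intros\<close>)
    then show ?thesis by simp
  qed
  have cont_h: "continuous_on {0..1} (\<lambda>t. t ^ j * h (a + t *\<^sub>R (x - a)))" if "x \<in> ball a r" for x
    by (intro continuous_intros continuous_on_compose2[OF smooth_on_continuous_on[OF Suc.prems]])
       (auto simp del: mem_ball intro!: dilation_in_ball that)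
  show ?case
  proof (rule Ck_on_SucI)
    fix x assume x: "x \<in> ball a r"
    have "((\<lambda>x. integral (cbox 0 1) (\<lambda>t. t ^ j * h (a + t *\<^sub>R (x - a)))) has_derivative
        integral (cbox 0 1) (G x)) (at x within ball a r)"
    proof (rule leibniz_rule[where fx = G])
      fix y t assume y: "y \<in> ball a r" and t: "t \<in> cbox (0::real) 1"
      have "((\<lambda>y. h (a + t *\<^sub>R (y - a))) has_derivative (\<lambda>b. ?h' (t *\<^sub>R b) (a + t *\<^sub>R (y - a)))) (at y)"
        by (rule has_derivative_compose[where f = "\<lambda>y. a + t *\<^sub>R (y - a)" and g = h,
              OF _ smooth_on_has_derivative[OF open_ball Suc.prems dilation_in_ball[OF y]]])
           (use t in \<open>auto intro!: derivative_eq_intros\<close>)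
      moreover have "linear (frechet_derivative h (at (a + t *\<^sub>R (y - a))))"
        using smooth_on_has_derivative[OF open_ball Suc.prems dilation_in_ball[OF y]] t has_derivative_linear by auto
      ultimately have "((\<lambda>y. t ^ j * h (a + t *\<^sub>R (y - a))) has_derivative
          (\<lambda>b. t ^ j * (t * ?h' b (a + t *\<^sub>R (y - a))))) (at y)"
        by (intro has_derivative_mult_right) (simp add: linear_scale)
      moreover have "(\<lambda>b. t ^ j * (t * ?h' b (a + t *\<^sub>R (y - a)))) = blinfun_apply (G y t)"
        using G_apply[OF y] t by (auto simp: mult_ac)
      ultimately show "((\<lambda>y. t ^ j * h (a + t *\<^sub>R (y - a))) has_derivative blinfun_apply (G y t)) (at y within ball a r)"
        by (simp add: has_derivative_at_withinI)
    qed (use x cont_G cont_h in \<open>auto intro: integrable_continuous_real\<close>)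
    then show "((\<lambda>x. integral {0..1} (\<lambda>t. t ^ j * h (a + t *\<^sub>R (x - a)))) has_derivative
        integral {0..1} (G x)) (at x)"
      using x by (simp add: at_within_open[of x "ball a r"])
  next
    fix b :: 'a assume b: "b \<in> Basis"
    have eq: "blinfun_apply (integral {0..1} (G x)) b = integral {0..1} (\<lambda>t. t ^ Suc j * ?h' b (a + t *\<^sub>R (x - a)))"
      if "x \<in> ball a r" for x
      by (subst blinfun_apply_integral[OF integrable_continuous_real[OF cont_G'[OF that]]])
         (auto intro!: integral_cong G_apply simp del: power_Suc mem_ball simp: that)
    show "Ck_on k (ball a r) (\<lambda>x. blinfun_apply (integral {0..1} (G x)) b)"
      by (rule Ck_on_cong[OF _ _ Suc.IH[OF smooth_h'[OF b], of "Suc j"]]) (use eq in auto)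
  qed simp
qed

lemma Hadamard:
  fixes f :: "'a::euclidean_space \<Rightarrow> real"
  assumes "smooth_on (ball a r) f" "r > 0"
  obtains g where "\<And>b. b \<in> Basis \<Longrightarrow> smooth_on (ball a r) (g b)"
    and "\<And>b. b \<in> Basis \<Longrightarrow> g b a = frechet_derivative f (at a) b"
    and "\<And>x. x \<in> ball a r \<Longrightarrow> f x = f a + (\<Sum>b\<in>Basis. ((x - a) \<bullet> b) * g b x)"
proof
  let ?f' = "\<lambda>b y. frechet_derivative f (at y) b"
  let ?g = "\<lambda>b x. integral {0..1} (\<lambda>t. ?f' b (a + t *\<^sub>R (x - a)))"
  show "smooth_on (ball a r) (?g b)" if "b \<in> Basis" for b
    unfolding smooth_on_def
    using Ck_on_integral_dilation[OF smooth_on_frechet_derivative[OF assms(1) that], of _ 0] by simp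
  show "?g b a = frechet_derivative f (at a) b" for b
    by simp
  fix x assume x: "x \<in> ball a r"
  have cont: "continuous_on {0..1} (\<lambda>t. ?f' b (a + t *\<^sub>R (x - a)))" if "b \<in> Basis" for b
    by (intro continuous_intros continuous_on_compose2[OF smooth_on_continuous_on[OF
        smooth_on_frechet_derivative[OF assms(1) that]]]) (auto simp del: mem_ball intro!: dilation_in_ball x)
  have "((\<lambda>t. \<Sum>b\<in>Basis. ((x - a) \<bullet> b) * ?f' b (a + t *\<^sub>R (x - a))) has_integral
      f (a + 1 *\<^sub>R (x - a)) - f (a + 0 *\<^sub>R (x - a))) {0..1}"
  proof (rule fundamental_theorem_of_calculus)
    fix t :: real assume t: "t \<in> {0..1}"
    note df = smooth_on_has_derivative[OF open_ball assms(1) dilation_in_ball[OF x t]]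
    have lin: "linear (frechet_derivative f (at (a + t *\<^sub>R (x - a))))"
      using df has_derivative_linear by auto
    have "((\<lambda>t. f (a + t *\<^sub>R (x - a))) has_derivative (\<lambda>h. ?f' (h *\<^sub>R (x - a)) (a + t *\<^sub>R (x - a)))) (at t)"
      by (rule has_derivative_compose[where f = "\<lambda>t. a + t *\<^sub>R (x - a)" and g = f, OF _ df]) (auto intro!: derivative_eq_intros)
    then have "((\<lambda>t. f (a + t *\<^sub>R (x - a))) has_vector_derivative ?f' (x - a) (a + t *\<^sub>R (x - a))) (at t)"
      by (simp add: has_vector_derivative_def linear_scale[OF lin])
    moreover have "?f' (x - a) (a + t *\<^sub>R (x - a)) = ?f' (\<Sum>b\<in>Basis. ((x - a) \<bullet> b) *\<^sub>R b) (a + t *\<^sub>R (x - a))"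
      by (simp add: euclidean_representation)
    ultimately show "((\<lambda>t. f (a + t *\<^sub>R (x - a))) has_vector_derivative
        (\<Sum>b\<in>Basis. ((x - a) \<bullet> b) * ?f' b (a + t *\<^sub>R (x - a)))) (at t within {0..1})"
      by (simp add: linear_sum[OF lin] linear_scale[OF lin] has_vector_derivative_at_within)
  qed simp
  moreover have "((\<lambda>t. \<Sum>b\<in>Basis. ((x - a) \<bullet> b) * ?f' b (a + t *\<^sub>R (x - a))) has_integral
      (\<Sum>b\<in>Basis. ((x - a) \<bullet> b) * ?g b x)) {0..1}"
    by (intro has_integral_sum has_integral_mult_right integrable_integral integrable_continuous_real cont) auto
  ultimately have "f (a + 1 *\<^sub>R (x - a)) - f (a + 0 *\<^sub>R (x - a)) = (\<Sum>b\<in>Basis. ((x - a) \<bullet> b) * ?g b x)"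
    by (rule has_integral_unique)
  then show "f x = f a + (\<Sum>b\<in>Basis. ((x - a) \<bullet> b) * ?g b x)" by simp
qed

lemma frechet_derivative_eqI: "(f has_derivative f') (at x) \<Longrightarrow> frechet_derivative f (at x) v = f' v"
  using frechet_derivative_at by metis

text \<open>With Hadamard's \<open>g\<close>, one has \<open>\<partial>\<^sub>u\<partial>\<^sub>v f (a) = \<partial>\<^sub>u g\<^sub>v (a) + \<partial>\<^sub>v g\<^sub>u (a)\<close>.\<close>
lemma frechet_derivative_commute:
  fixes f :: "'a::euclidean_space \<Rightarrow> real"
  assumes "open S" "a \<in> S" "smooth_on S f" "u \<in> Basis" "v \<in> Basis"
  shows "frechet_derivative (\<lambda>x. frechet_derivative f (at x) v) (at a) u =
    frechet_derivative (\<lambda>x. frechet_derivative f (at x) u) (at a) v"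
proof -
  obtain r where r: "r > 0" "ball a r \<subseteq> S"
    using assms(1,2) open_contains_ball by blast
  have sf: "smooth_on (ball a r) f" using assms(3) r smooth_on_subset by blast
  obtain g where g: "\<And>b. b \<in> Basis \<Longrightarrow> smooth_on (ball a r) (g b)"
    and fg: "\<And>x. x \<in> ball a r \<Longrightarrow> f x = f a + (\<Sum>b\<in>Basis. ((x - a) \<bullet> b) * g b x)"
    using Hadamard[OF sf r(1)] by metis
  have dg: "g b differentiable at x" if "b \<in> Basis" "x \<in> ball a r" for b x
    using smooth_on_has_derivative[OF _ g[OF that(1)] that(2)] by (auto simp: differentiable_def)
  have dg': "(\<lambda>x. frechet_derivative (g b) (at x) w) differentiable at a" if "b \<in> Basis" "w \<in> Basis" for b w
    using smooth_on_has_derivative[OF _ smooth_on_frechet_derivative[OF g[OF that(1)] that(2)], of a] r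
    by (auto simp: differentiable_def)
  have df: "frechet_derivative f (at x) w =
      (\<Sum>b\<in>Basis. ((x - a) \<bullet> b) * frechet_derivative (g b) (at x) w) + g w x"
    if x: "x \<in> ball a r" and w: "w \<in> Basis" for x w
  proof -
    have "((\<lambda>x. f a + (\<Sum>b\<in>Basis. ((x - a) \<bullet> b) * g b x)) has_derivative
        (\<lambda>w. \<Sum>b\<in>Basis. ((x - a) \<bullet> b) * frechet_derivative (g b) (at x) w + (w \<bullet> b) * g b x)) (at x)"
      using dg[OF _ x, unfolded frechet_derivative_works]
      by (auto intro!: derivative_eq_intros)
    then have "(f has_derivative
        (\<lambda>w. \<Sum>b\<in>Basis. ((x - a) \<bullet> b) * frechet_derivative (g b) (at x) w + (w \<bullet> b) * g b x)) (at x)"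
      by (rule has_derivative_transform_within_open[OF _ open_ball x]) (simp add: fg)
    then have "frechet_derivative f (at x) w =
        (\<Sum>b\<in>Basis. ((x - a) \<bullet> b) * frechet_derivative (g b) (at x) w + (w \<bullet> b) * g b x)"
      by (rule frechet_derivative_eqI)
    moreover have "(\<Sum>b\<in>Basis. (w \<bullet> b) * g b x) = (\<Sum>b\<in>Basis. if b = w then g b x else 0)"
      by (intro sum.cong) (auto simp: inner_Basis w)
    ultimately show ?thesis using w by (simp add: sum.distrib)
  qed
  have "frechet_derivative (\<lambda>x. frechet_derivative f (at x) w) (at a) z =
      frechet_derivative (g z) (at a) w + frechet_derivative (g w) (at a) z"
    if w: "w \<in> Basis" and z: "z \<in> Basis" for w z
  proof -
    have "((\<lambda>x. (\<Sum>b\<in>Basis. ((x - a) \<bullet> b) * frechet_derivative (g b) (at x) w) + g w x) has_derivative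
        (\<lambda>z. (\<Sum>b\<in>Basis. (z \<bullet> b) * frechet_derivative (g b) (at a) w)
          + frechet_derivative (g w) (at a) z)) (at a)"
    proof (rule has_derivative_eq_rhs)
      show "((\<lambda>x. (\<Sum>b\<in>Basis. ((x - a) \<bullet> b) * frechet_derivative (g b) (at x) w) + g w x) has_derivative
        (\<lambda>z. (\<Sum>b\<in>Basis. ((a - a) \<bullet> b) * frechet_derivative (\<lambda>x. frechet_derivative (g b) (at x) w) (at a) z
            + (z \<bullet> b) * frechet_derivative (g b) (at a) w)
          + frechet_derivative (g w) (at a) z)) (at a)"
        using dg'[OF _ w, unfolded frechet_derivative_works] dg[OF w, of a, unfolded frechet_derivative_works] r(1)
        by (intro has_derivative_add has_derivative_sum has_derivative_mult) (auto intro!: derivative_eq_intros)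
    qed simp
    then have "((\<lambda>x. frechet_derivative f (at x) w) has_derivative
        (\<lambda>z. (\<Sum>b\<in>Basis. (z \<bullet> b) * frechet_derivative (g b) (at a) w)
          + frechet_derivative (g w) (at a) z)) (at a)"
      by (rule has_derivative_transform_within_open[where s = "ball a r"]) (use r w in \<open>simp_all add: df\<close>)
    then have "frechet_derivative (\<lambda>x. frechet_derivative f (at x) w) (at a) z =
        (\<Sum>b\<in>Basis. (z \<bullet> b) * frechet_derivative (g b) (at a) w) + frechet_derivative (g w) (at a) z"
      by (rule frechet_derivative_eqI)
    also have "(\<Sum>b\<in>Basis. (z \<bullet> b) * frechet_derivative (g b) (at a) w) =
        (\<Sum>b\<in>Basis. if b = z then frechet_derivative (g b) (at a) w else 0)"
      by (intro sum.cong) (auto simp: inner_Basis z)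
    finally show ?thesis using z by simp
  qed
  then show ?thesis using assms(4,5) by (simp add: add.commute)
qed

section \<open>Tangent vectors and vector fields\<close>

lemma sum_fun_apply: "(\<Sum>i\<in>I. f i) x = (\<Sum>i\<in>I. f i x)"
  by (induction I rule: infinite_finite_induct) auto

lemma sum_Basis_vec: "(\<Sum>b\<in>Basis. f (b :: real ^ 'm::finite)) = (\<Sum>i\<in>UNIV. f (axis i 1))"
proof -
  have "Basis = range (\<lambda>i::'m. axis i (1::real))"
    by (auto simp: Basis_vec_def)
  moreover have "inj (\<lambda>i::'m. axis i (1::real))"
    by (auto simp: inj_on_def axis_eq_axis)
  ultimately show ?thesis using sum.reindex[of "\<lambda>i::'m. axis i (1::real)" UNIV f] by (simp add: o_def)
qed

lemma is_chartD:
  assumes "is_chart (U, \<phi>)"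
  shows "open U" "open (\<phi> ` U)" "continuous_on U \<phi>" "continuous_on (\<phi> ` U) (inv_into U \<phi>)"
    "\<And>q. q \<in> U \<Longrightarrow> inv_into U \<phi> (\<phi> q) = q"
  using assms by (auto simp: is_chart_def homeomorphism_def)

lemma open_chart_image:
  assumes "is_chart (U, \<phi>)" "open W" "W \<subseteq> U"
  shows "open (\<phi> ` W)"
proof -
  have "\<phi> ` W = inv_into U \<phi> -` W \<inter> \<phi> ` U"
    using assms(3) is_chartD(5)[OF assms(1)] by auto
  then show ?thesis
    using is_chartD(2,4)[OF assms(1)] assms(2) continuous_on_open_vimage by metis
qed

lemma smooth_transitionD:
  assumes "smooth_transition (U, \<phi>) (V, \<psi>)"
  shows "smooth_on (\<phi> ` (U \<inter> V)) (\<lambda>y. \<psi> (inv_into U \<phi> y))"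
  using assms by (simp add: smooth_transition_def o_def)

locale manifold =
  fixes A :: "('p::{t2_space, second_countable_topology}, 'm::finite) chart set"
  assumes smooth_manifold: "smooth_manifold A"
begin

lemma smooth_chart_atlas: "c \<in> A \<Longrightarrow> smooth_chart A c"
  using smooth_manifold by (simp add: smooth_manifold_def smooth_chart_def)

lemma atlas_cover:
  obtains V \<psi> where "(V, \<psi>) \<in> A" "q \<in> V"
proof -
  have "q \<in> (\<Union>c\<in>A. fst c)" using smooth_manifold by (simp add: smooth_manifold_def)
  then show ?thesis using that by auto
qed

lemma smooth_functionsI:
  "(\<And>V \<psi>. (V, \<psi>) \<in> A \<Longrightarrow> smooth_on (\<psi> ` V) (\<lambda>y. f (inv_into V \<psi> y))) \<Longrightarrow> f \<in> smooth_functions A"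
  by (auto simp: smooth_functions_def o_def)

lemma smooth_functionsD:
  "f \<in> smooth_functions A \<Longrightarrow> (V, \<psi>) \<in> A \<Longrightarrow> smooth_on (\<psi> ` V) (\<lambda>y. f (inv_into V \<psi> y))"
  by (auto simp: smooth_functions_def o_def)

lemma atlas_open_image: "(V, \<psi>) \<in> A \<Longrightarrow> open (\<psi> ` V)"
  using smooth_chart_atlas[of "(V, \<psi>)"] is_chartD(2)[of V \<psi>] by (simp add: smooth_chart_def)

lemma smooth_functions_const: "(\<lambda>q. c) \<in> smooth_functions A"
  by (intro smooth_functionsI smooth_on_const atlas_open_image)

lemma smooth_functions_add:
  "f \<in> smooth_functions A \<Longrightarrow> g \<in> smooth_functions A \<Longrightarrow> (\<lambda>q. f q + g q) \<in> smooth_functions A"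
  by (rule smooth_functionsI, rule smooth_on_add[OF atlas_open_image smooth_functionsD smooth_functionsD])

lemma smooth_functions_mult:
  "f \<in> smooth_functions A \<Longrightarrow> g \<in> smooth_functions A \<Longrightarrow> (\<lambda>q. f q * g q) \<in> smooth_functions A"
  by (rule smooth_functionsI, rule smooth_on_mult[OF atlas_open_image smooth_functionsD smooth_functionsD])

lemma smooth_functions_lincomb:
  "f \<in> smooth_functions A \<Longrightarrow> g \<in> smooth_functions A \<Longrightarrow> (\<lambda>q. a * f q + b * g q) \<in> smooth_functions A"
  by (intro smooth_functions_add smooth_functions_mult smooth_functions_const)

lemma smooth_functions_sum:
  "(\<And>i. i \<in> I \<Longrightarrow> f i \<in> smooth_functions A) \<Longrightarrow> (\<lambda>q. \<Sum>i\<in>I. f i q) \<in> smooth_functions A"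
  by (induction I rule: infinite_finite_induct)
     (auto intro: smooth_functions_const smooth_functions_add)

lemma tangent_lincomb:
  "v \<in> tangent_space A p \<Longrightarrow> f \<in> smooth_functions A \<Longrightarrow> g \<in> smooth_functions A \<Longrightarrow>
   v (\<lambda>q. a * f q + b * g q) = a * v f + b * v g"
  by (simp add: tangent_space_def)

lemma tangent_product:
  "v \<in> tangent_space A p \<Longrightarrow> f \<in> smooth_functions A \<Longrightarrow> g \<in> smooth_functions A \<Longrightarrow>
   v (\<lambda>q. f q * g q) = f p * v g + g p * v f"
  by (simp add: tangent_space_def)

lemma tangent_nonsmooth: "v \<in> tangent_space A p \<Longrightarrow> f \<notin> smooth_functions A \<Longrightarrow> v f = 0"
  by (simp add: tangent_space_def)

lemma tangent_zero_fun: "v \<in> tangent_space A p \<Longrightarrow> v (\<lambda>q. 0) = 0"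
  using tangent_lincomb[of v p "\<lambda>q. 0" "\<lambda>q. 0" 0 0] smooth_functions_const by simp

lemma tangent_scale:
  "v \<in> tangent_space A p \<Longrightarrow> f \<in> smooth_functions A \<Longrightarrow> v (\<lambda>q. f q * c) = c * v f"
  using tangent_lincomb[of v p f f c 0] by (simp add: mult.commute)

lemma tangent_sum:
  assumes "v \<in> tangent_space A p" "\<And>i. i \<in> I \<Longrightarrow> f i \<in> smooth_functions A"
  shows "v (\<lambda>q. \<Sum>i\<in>I. f i q) = (\<Sum>i\<in>I. v (f i))"
  using assms(2)
proof (induction I rule: infinite_finite_induct)
  case (insert i I)
  then show ?case
    using tangent_lincomb[OF assms(1), of "f i" "\<lambda>q. \<Sum>i\<in>I. f i q" 1 1] smooth_functions_sum[of I f]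
    by simp
qed (simp_all add: tangent_zero_fun[OF assms(1)])

lemma tangent_space_zero: "0 \<in> tangent_space A p"
  by (simp add: tangent_space_def)

lemma tangent_space_add: "v \<in> tangent_space A p \<Longrightarrow> w \<in> tangent_space A p \<Longrightarrow> v + w \<in> tangent_space A p"
  by (simp add: tangent_space_def algebra_simps)

lemma tangent_space_diff: "v \<in> tangent_space A p \<Longrightarrow> w \<in> tangent_space A p \<Longrightarrow> v - w \<in> tangent_space A p"
  by (simp add: tangent_space_def algebra_simps)

lemma tangent_space_tscale: "v \<in> tangent_space A p \<Longrightarrow> tscale c v \<in> tangent_space A p"
  by (simp add: tangent_space_def tscale_def algebra_simps)

lemma tangent_space_sum:
  "(\<And>i. i \<in> I \<Longrightarrow> v i \<in> tangent_space A p) \<Longrightarrow> (\<Sum>i\<in>I. v i) \<in> tangent_space A p"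
  by (induction I rule: infinite_finite_induct) (auto intro: tangent_space_zero tangent_space_add)

lemma vector_fieldsD: "X \<in> vector_fields A \<Longrightarrow> X p \<in> tangent_space A p"
  by (simp add: vector_fields_def)

lemma vact_smooth: "X \<in> vector_fields A \<Longrightarrow> f \<in> smooth_functions A \<Longrightarrow> vact X f \<in> smooth_functions A"
  by (simp add: vector_fields_def)

lemma vector_fields_zero: "0 \<in> vector_fields A"
  using smooth_functions_const[of 0] tangent_space_zero by (simp add: vector_fields_def vact_def)

lemma vector_fields_add: "X \<in> vector_fields A \<Longrightarrow> Y \<in> vector_fields A \<Longrightarrow> X + Y \<in> vector_fields A"
  using smooth_functions_add by (auto simp: vector_fields_def vact_def intro: tangent_space_add)

lemma vector_fields_diff:
  assumes "X \<in> vector_fields A" "Y \<in> vector_fields A"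
  shows "X - Y \<in> vector_fields A"
  using assms smooth_functions_lincomb[of _ _ 1 "-1"]
  by (auto simp: vector_fields_def vact_def intro: tangent_space_diff)

lemma vector_fields_fscale:
  "f \<in> smooth_functions A \<Longrightarrow> X \<in> vector_fields A \<Longrightarrow> fscale f X \<in> vector_fields A"
  using smooth_functions_mult
  by (auto simp: vector_fields_def vact_def fscale_def intro: tangent_space_tscale) (simp add: tscale_def)

lemma vector_fields_sum:
  "(\<And>i. i \<in> I \<Longrightarrow> X i \<in> vector_fields A) \<Longrightarrow> (\<Sum>i\<in>I. X i) \<in> vector_fields A"
  by (induction I rule: infinite_finite_induct) (auto intro: vector_fields_zero vector_fields_add)

lemma vact_lincomb:
  "X \<in> vector_fields A \<Longrightarrow> f \<in> smooth_functions A \<Longrightarrow> g \<in> smooth_functions A \<Longrightarrow>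
   vact X (\<lambda>q. a * f q + b * g q) = (\<lambda>q. a * vact X f q + b * vact X g q)"
  by (simp add: vact_def fun_eq_iff tangent_lincomb[OF vector_fieldsD])

lemma vact_product:
  "X \<in> vector_fields A \<Longrightarrow> f \<in> smooth_functions A \<Longrightarrow> g \<in> smooth_functions A \<Longrightarrow>
   vact X (\<lambda>q. f q * g q) = (\<lambda>q. f q * vact X g q + g q * vact X f q)"
  by (simp add: vact_def fun_eq_iff tangent_product[OF vector_fieldsD])

lemma vector_fields_lie_bracket:
  assumes X: "X \<in> vector_fields A" and Y: "Y \<in> vector_fields A"
  shows "lie_bracket X Y \<in> vector_fields A"
proof -
  note Xp = vector_fieldsD[OF X] and Yp = vector_fieldsD[OF Y]
  note sX = vact_smooth[OF X] and sY = vact_smooth[OF Y]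
  have add: "v (\<lambda>q. f q + g q) = v f + v g"
    if "v \<in> tangent_space A p" "f \<in> smooth_functions A" "g \<in> smooth_functions A" for v p f g
    using tangent_lincomb[OF that, of 1 1] by simp
  have "lie_bracket X Y p \<in> tangent_space A p" for p
    unfolding tangent_space_def
  proof (intro CollectI conjI ballI allI impI)
    fix f g a b assume f: "f \<in> smooth_functions A" and g: "g \<in> smooth_functions A"
    show "lie_bracket X Y p (\<lambda>q. a * f q + b * g q) = a * lie_bracket X Y p f + b * lie_bracket X Y p g"
      by (simp add: lie_bracket_def vact_lincomb[OF X f g] vact_lincomb[OF Y f g]
          tangent_lincomb[OF Xp sY[OF f] sY[OF g]] tangent_lincomb[OF Yp sX[OF f] sX[OF g]] algebra_simps)
  next
    fix f g assume f: "f \<in> smooth_functions A" and g: "g \<in> smooth_functions A"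
    show "lie_bracket X Y p (\<lambda>q. f q * g q) = f p * lie_bracket X Y p g + g p * lie_bracket X Y p f"
      by (simp add: lie_bracket_def vact_product[OF X f g] vact_product[OF Y f g]
          add[OF Xp smooth_functions_mult[OF f sY[OF g]] smooth_functions_mult[OF g sY[OF f]]]
          add[OF Yp smooth_functions_mult[OF f sX[OF g]] smooth_functions_mult[OF g sX[OF f]]]
          tangent_product[OF Xp f sY[OF g]] tangent_product[OF Xp g sY[OF f]]
          tangent_product[OF Yp f sX[OF g]] tangent_product[OF Yp g sX[OF f]])
         (simp add: vact_def algebra_simps)
  next
    fix f assume f: "f \<notin> smooth_functions A"
    have "vact X f = (\<lambda>q. 0)" "vact Y f = (\<lambda>q. 0)"
      using tangent_nonsmooth[OF Xp f] tangent_nonsmooth[OF Yp f] by (auto simp: vact_def)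
    then show "lie_bracket X Y p f = 0"
      by (simp add: lie_bracket_def tangent_zero_fun[OF Xp] tangent_zero_fun[OF Yp])
  qed
  moreover have "vact (lie_bracket X Y) f \<in> smooth_functions A" if f: "f \<in> smooth_functions A" for f
  proof -
    have "vact (lie_bracket X Y) f = (\<lambda>q. 1 * vact X (vact Y f) q + (- 1) * vact Y (vact X f) q)"
      by (simp add: vact_def lie_bracket_def)
    then show ?thesis using smooth_functions_lincomb[OF sX[OF sY[OF f]] sY[OF sX[OF f]], of 1 "-1"] by simp
  qed
  ultimately show ?thesis by (simp add: vector_fields_def)
qed

end

locale manifold_chart = manifold +
  fixes U \<phi>
  assumes smooth_chart: "smooth_chart A (U, \<phi>)"
begin

abbreviation coord :: "'b \<Rightarrow> 'a \<Rightarrow> 'a tangent" ("\<partial>") where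
  "coord \<equiv> coord_vector A (U, \<phi>)"

abbreviation pd :: "'b \<Rightarrow> ('a \<Rightarrow> real) \<Rightarrow> 'a \<Rightarrow> real" where
  "pd \<equiv> partial_deriv (U, \<phi>)"

lemma is_chart: "is_chart (U, \<phi>)"
  using smooth_chart by (simp add: smooth_chart_def)

lemmas open_domain = is_chartD(1)[OF is_chart]
  and open_range = is_chartD(2)[OF is_chart]
  and continuous_inv = is_chartD(4)[OF is_chart]
  and inv_chart [simp] = is_chartD(5)[OF is_chart]

lemma smooth_function_chart:
  assumes f: "f \<in> smooth_functions A"
  shows "smooth_on (\<phi> ` U) (\<lambda>y. f (inv_into U \<phi> y))"
proof (rule smooth_on_local[OF open_range])
  fix y assume "y \<in> \<phi> ` U"
  then obtain q where q: "q \<in> U" "y = \<phi> q" by auto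
  obtain V \<psi> where V: "(V, \<psi>) \<in> A" "q \<in> V" using atlas_cover by blast
  have V_chart: "is_chart (V, \<psi>)" using smooth_chart_atlas[OF V(1)] by (simp add: smooth_chart_def)
  have W: "open (\<phi> ` (U \<inter> V))"
    using open_chart_image[OF is_chart, of "U \<inter> V"] open_domain is_chartD(1)[OF V_chart] by auto
  have "smooth_on (\<phi> ` (U \<inter> V)) (\<lambda>y. \<psi> (inv_into U \<phi> y))"
    using smooth_chart V(1) by (intro smooth_transitionD) (auto simp: smooth_chart_def)
  then have "smooth_on (\<phi> ` (U \<inter> V)) (\<lambda>y. f (inv_into V \<psi> (\<psi> (inv_into U \<phi> y))))"
    by (intro smooth_on_compose[OF W atlas_open_image[OF V(1)] _ _ smooth_functionsD[OF f V(1)]]) auto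
  then have "smooth_on (\<phi> ` (U \<inter> V)) (\<lambda>y. f (inv_into U \<phi> y))"
    by (rule smooth_on_cong[OF W, rotated]) (auto simp: is_chartD(5)[OF V_chart])
  then show "\<exists>T. open T \<and> y \<in> T \<and> smooth_on T (\<lambda>y. f (inv_into U \<phi> y))"
    using W q V by blast
qed

definition extension :: "(real ^ 'b \<Rightarrow> real) \<Rightarrow> 'a \<Rightarrow> real" where
  "extension F q = (if q \<in> U then F (\<phi> q) else 0)"

lemma extension_smooth:
  assumes F: "smooth_on UNIV F" and zero: "\<And>x. x \<notin> C \<Longrightarrow> F x = 0" and C: "compact C" "C \<subseteq> \<phi> ` U"
  shows "extension F \<in> smooth_functions A"
proof (rule smooth_functionsI)
  fix V \<psi> assume V: "(V, \<psi>) \<in> A"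
  have V_chart: "is_chart (V, \<psi>)" using smooth_chart_atlas[OF V] by (simp add: smooth_chart_def)
  have "closed (inv_into U \<phi> ` C)"
    using C by (intro compact_imp_closed compact_continuous_image continuous_on_subset[OF continuous_inv])
  then have open_compl: "open (V - inv_into U \<phi> ` C)"
    using is_chartD(1)[OF V_chart] by auto
  show "smooth_on (\<psi> ` V) (\<lambda>y. extension F (inv_into V \<psi> y))"
  proof (rule smooth_on_local[OF atlas_open_image[OF V]])
    fix y assume "y \<in> \<psi> ` V"
    then obtain q where q: "q \<in> V" "y = \<psi> q" by auto
    show "\<exists>T. open T \<and> y \<in> T \<and> smooth_on T (\<lambda>y. extension F (inv_into V \<psi> y))"
    proof (cases "q \<in> U")
      case True
      have W: "open (\<psi> ` (V \<inter> U))"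
        using open_chart_image[OF V_chart, of "V \<inter> U"] open_domain is_chartD(1)[OF V_chart] by auto
      have "smooth_on (\<psi> ` (V \<inter> U)) (\<lambda>y. \<phi> (inv_into V \<psi> y))"
        using smooth_chart V by (intro smooth_transitionD) (auto simp: smooth_chart_def)
      then have "smooth_on (\<psi> ` (V \<inter> U)) (\<lambda>y. F (\<phi> (inv_into V \<psi> y)))"
        by (intro smooth_on_compose[OF W _ _ _ F]) auto
      then have "smooth_on (\<psi> ` (V \<inter> U)) (\<lambda>y. extension F (inv_into V \<psi> y))"
        by (rule smooth_on_cong[OF W, rotated]) (auto simp: is_chartD(5)[OF V_chart] extension_def)
      then show ?thesis using W q True by blast
    next
      case False
      have W: "open (\<psi> ` (V - inv_into U \<phi> ` C))"
        by (rule open_chart_image[OF V_chart open_compl]) auto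
      have "extension F r = 0" if "r \<notin> inv_into U \<phi> ` C" for r
        using that zero[of "\<phi> r"] by (force simp: extension_def)
      then have "smooth_on (\<psi> ` (V - inv_into U \<phi> ` C)) (\<lambda>y. extension F (inv_into V \<psi> y))"
        by (intro smooth_on_cong[OF W _ smooth_on_const[OF W, of 0]]) (auto simp: is_chartD(5)[OF V_chart])
      moreover have "q \<notin> inv_into U \<phi> ` C"
        using False C(2) by auto
      ultimately show ?thesis using W q by blast
    qed
  qed
qed

definition bump_at :: "'a \<Rightarrow> real \<Rightarrow> (real ^ 'b \<Rightarrow> real) \<Rightarrow> 'a \<Rightarrow> real" where
  "bump_at p r G = extension (\<lambda>x. bump (\<phi> p) r x * G x)"

lemma bump_at_smooth:
  assumes "r > 0" "cball (\<phi> p) r \<subseteq> V" "open V" "smooth_on V G" "V \<subseteq> \<phi> ` U"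
  shows "bump_at p r G \<in> smooth_functions A"
  unfolding bump_at_def
  by (rule extension_smooth[OF smooth_bump_mult[OF assms(1,3,2,4)], where C = "cball (\<phi> p) r"])
     (use assms in \<open>auto simp: bump_outside\<close>)

lemma chart_ball:
  assumes "p \<in> U"
  obtains R where "R > 0" "ball (\<phi> p) R \<subseteq> \<phi> ` U"
  using open_range assms open_contains_ball by blast

lemma chart_cball:
  assumes "p \<in> U"
  obtains r where "r > 0" "cball (\<phi> p) r \<subseteq> \<phi> ` U"
  using open_range assms open_contains_cball by blast

lemma chart_differentiable:
  assumes "f \<in> smooth_functions A" "p \<in> U"
  shows "(\<lambda>y. f (inv_into U \<phi> y)) differentiable at (\<phi> p)"
  using smooth_on_has_derivative[OF open_range smooth_function_chart[OF assms(1)], of "\<phi> p"] assms(2)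
  by (auto simp: differentiable_def)

lemma pd_eq: "pd I f p = frechet_derivative (\<lambda>y. f (inv_into U \<phi> y)) (at (\<phi> p)) (axis I 1)"
  by (simp add: partial_deriv_def o_def)

lemma pd_eqI:
  "((\<lambda>y. f (inv_into U \<phi> y)) has_derivative f') (at (\<phi> p)) \<Longrightarrow> pd I f p = f' (axis I 1)"
  unfolding pd_eq by (rule frechet_derivative_eqI)

lemma coord_smooth: "f \<in> smooth_functions A \<Longrightarrow> \<partial> I p f = pd I f p"
  by (simp add: coord_vector_def)

lemma coord_in_tangent_space:
  assumes p: "p \<in> U"
  shows "\<partial> I p \<in> tangent_space A p"
  unfolding tangent_space_def
proof (intro CollectI conjI ballI allI impI)
  fix f g a b assume f: "f \<in> smooth_functions A" and g: "g \<in> smooth_functions A"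
  note df = chart_differentiable[OF f p, unfolded frechet_derivative_works]
    and dg = chart_differentiable[OF g p, unfolded frechet_derivative_works]
  have "pd I (\<lambda>q. a * f q + b * g q) p = a * pd I f p + b * pd I g p"
    using pd_eqI[OF has_derivative_add[OF has_derivative_mult_right[OF df] has_derivative_mult_right[OF dg]]]
    by (simp add: pd_eq)
  then show "\<partial> I p (\<lambda>q. a * f q + b * g q) = a * \<partial> I p f + b * \<partial> I p g"
    by (simp add: coord_smooth f g smooth_functions_lincomb)
next
  fix f g assume f: "f \<in> smooth_functions A" and g: "g \<in> smooth_functions A"
  note df = chart_differentiable[OF f p, unfolded frechet_derivative_works]
    and dg = chart_differentiable[OF g p, unfolded frechet_derivative_works]
  have "pd I (\<lambda>q. f q * g q) p = f p * pd I g p + g p * pd I f p"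
    using pd_eqI[OF has_derivative_mult[OF df dg]] p by (simp add: pd_eq)
  then show "\<partial> I p (\<lambda>q. f q * g q) = f p * \<partial> I p g + g p * \<partial> I p f"
    by (simp add: coord_smooth f g smooth_functions_mult)
qed (simp add: coord_vector_def)

text \<open>Multiplying Hadamard's expansion of \<open>f\<close> at \<open>p\<close> twice by a bump function makes all its terms
  global smooth functions, to which the derivation \<open>v\<close> applies.\<close>
lemma tangent_space_coord:
  assumes p: "p \<in> U" and v: "v \<in> tangent_space A p"
  obtains a where "v = (\<Sum>I\<in>UNIV. tscale (a I) (\<partial> I p))"
proof -
  obtain R where R: "R > 0" "ball (\<phi> p) R \<subseteq> \<phi> ` U" using chart_ball[OF p] .
  define r where "r = R / 2"
  have r: "r > 0" "cball (\<phi> p) r \<subseteq> ball (\<phi> p) R" using R by (auto simp: r_def)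
  define e where "e b = bump_at p r (\<lambda>x. (x - \<phi> p) \<bullet> b)" for b
  define h where "h = bump_at p r (\<lambda>x. 1)"
  have e: "e b \<in> smooth_functions A" for b
    unfolding e_def by (rule bump_at_smooth[OF r open_ball smooth_on_coordinate R(2)]) simp
  have h: "h \<in> smooth_functions A"
    unfolding h_def by (rule bump_at_smooth[OF r open_ball smooth_on_const R(2)]) simp
  have e_p: "e b p = 0" for b by (simp add: e_def bump_at_def extension_def)
  have h_p: "h p = 1" by (simp add: h_def bump_at_def extension_def p r)
  have "v f = (\<Sum>I\<in>UNIV. v (e (axis I 1)) * \<partial> I p f)" if f: "f \<in> smooth_functions A" for f
  proof -
    have "smooth_on (ball (\<phi> p) R) (\<lambda>y. f (inv_into U \<phi> y))"
      by (rule smooth_on_subset[OF open_ball smooth_function_chart[OF f] R(2)])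
    then obtain g where g: "\<And>b. b \<in> Basis \<Longrightarrow> smooth_on (ball (\<phi> p) R) (g b)"
      and g_p: "\<And>b. b \<in> Basis \<Longrightarrow> g b (\<phi> p) = frechet_derivative (\<lambda>y. f (inv_into U \<phi> y)) (at (\<phi> p)) b"
      and f_eq: "\<And>x. x \<in> ball (\<phi> p) R \<Longrightarrow>
        f (inv_into U \<phi> x) = f (inv_into U \<phi> (\<phi> p)) + (\<Sum>b\<in>Basis. ((x - \<phi> p) \<bullet> b) * g b x)"
      using Hadamard[OF _ R(1)] by blast
    define G where "G b = bump_at p r (g b)" for b
    have G: "G b \<in> smooth_functions A" if "b \<in> Basis" for b
      unfolding G_def by (rule bump_at_smooth[OF r(1,2) open_ball g[OF that] R(2)])
    have G_p: "G b p = frechet_derivative (\<lambda>y. f (inv_into U \<phi> y)) (at (\<phi> p)) b" if "b \<in> Basis" for b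
      using g_p[OF that] by (simp add: G_def bump_at_def extension_def p r)
    have eq: "(\<lambda>q. (h q * h q) * f q) = (\<lambda>q. 1 * ((h q * h q) * f p) + 1 * (\<Sum>b\<in>Basis. e b q * G b q))"
    proof
      fix q
      show "(h q * h q) * f q = 1 * ((h q * h q) * f p) + 1 * (\<Sum>b\<in>Basis. e b q * G b q)"
      proof (cases "q \<in> U \<and> \<phi> q \<in> ball (\<phi> p) R")
        case True
        then have "f q = f p + (\<Sum>b\<in>Basis. ((\<phi> q - \<phi> p) \<bullet> b) * g b (\<phi> q))"
          using f_eq[of "\<phi> q"] p by simp
        then have "(h q * h q) * f q = (h q * h q) * f p
            + (\<Sum>b\<in>Basis. (h q * h q) * (((\<phi> q - \<phi> p) \<bullet> b) * g b (\<phi> q)))"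
          by (simp add: distrib_left sum_distrib_left)
        then show ?thesis
          using True by (simp add: h_def e_def G_def bump_at_def extension_def mult_ac)
      next
        case False
        then have "\<phi> q \<notin> cball (\<phi> p) r" if "q \<in> U" using that r by auto
        then show ?thesis
          by (auto simp: h_def e_def G_def bump_at_def extension_def bump_outside r)
      qed
    qed
    have h2: "(\<lambda>q. h q * h q) \<in> smooth_functions A" by (rule smooth_functions_mult[OF h h])
    have "v (\<lambda>q. (h q * h q) * f q) = v (\<lambda>q. (h q * h q) * f p) + v (\<lambda>q. \<Sum>b\<in>Basis. e b q * G b q)"
      unfolding eq using tangent_lincomb[OF v, of _ _ 1 1] smooth_functions_mult[OF h2 smooth_functions_const]
        smooth_functions_sum[of Basis "\<lambda>b q. e b q * G b q"] smooth_functions_mult[OF e G]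
      by simp
    moreover have "v (\<lambda>q. (h q * h q) * f q) = v f + f p * v (\<lambda>q. h q * h q)"
      using tangent_product[OF v h2 f] h_p by simp
    moreover have "v (\<lambda>q. (h q * h q) * f p) = f p * v (\<lambda>q. h q * h q)"
      using tangent_scale[OF v h2] by simp
    moreover have "v (\<lambda>q. \<Sum>b\<in>Basis. e b q * G b q) = (\<Sum>b\<in>Basis. v (\<lambda>q. e b q * G b q))"
      using smooth_functions_mult[OF e G] by (intro tangent_sum[OF v]) auto
    moreover have "(\<Sum>b\<in>Basis. v (\<lambda>q. e b q * G b q)) = (\<Sum>b\<in>Basis. G b p * v (e b))"
      using tangent_product[OF v e G] e_p by (intro sum.cong) auto
    ultimately have "v f = (\<Sum>b\<in>Basis. G b p * v (e b))" by simp
    also have "\<dots> = (\<Sum>I\<in>UNIV. v (e (axis I 1)) * \<partial> I p f)"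
      by (simp add: sum_Basis_vec G_p coord_smooth f pd_eq mult.commute)
    finally show ?thesis .
  qed
  then have "v = (\<Sum>I\<in>UNIV. tscale (v (e (axis I 1))) (\<partial> I p))"
    using tangent_nonsmooth[OF v]
    by (auto simp: fun_eq_iff sum_fun_apply tscale_def) (metis (no_types, lifting) coord_vector_def mult_zero_right sum.neutral)
  then show ?thesis using that[of "\<lambda>I. v (e (axis I 1))"] by blast
qed

definition coord_bump :: "'a \<Rightarrow> real \<Rightarrow> 'b \<Rightarrow> 'a vfield" where
  "coord_bump p r J = fscale (bump_at p r (\<lambda>x. 1)) (\<partial> J)"

lemma coord_bump_vector_field:
  assumes "r > 0" "cball (\<phi> p) r \<subseteq> \<phi> ` U"
  shows "coord_bump p r J \<in> vector_fields A"
  unfolding vector_fields_def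
proof (intro CollectI conjI allI ballI)
  fix q show "coord_bump p r J q \<in> tangent_space A q"
  proof (cases "q \<in> U")
    case True
    then show ?thesis
      by (simp add: coord_bump_def fscale_def tangent_space_tscale coord_in_tangent_space)
  next
    case False
    then have "coord_bump p r J q = 0"
      by (simp add: coord_bump_def fscale_def bump_at_def extension_def tscale_def fun_eq_iff)
    then show ?thesis by (simp add: tangent_space_zero)
  qed
next
  fix f assume f: "f \<in> smooth_functions A"
  have "vact (coord_bump p r J) f =
      bump_at p r (\<lambda>x. frechet_derivative (\<lambda>y. f (inv_into U \<phi> y)) (at x) (axis J 1))"
    by (auto simp: fun_eq_iff vact_def coord_bump_def fscale_def tscale_def bump_at_def extension_def
        coord_smooth f pd_eq)
  also have "\<dots> \<in> smooth_functions A"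
    by (rule bump_at_smooth[OF assms open_range smooth_on_frechet_derivative[OF smooth_function_chart[OF f]]])
       (auto simp: axis_in_Basis_iff)
  finally show "vact (coord_bump p r J) f \<in> smooth_functions A" .
qed

lemma coord_bump_center: "p \<in> U \<Longrightarrow> r > 0 \<Longrightarrow> coord_bump p r J p = \<partial> J p"
  by (simp add: coord_bump_def fscale_def bump_at_def extension_def tscale_def)

end

context manifold
begin

lemma vector_field_through:
  assumes "v \<in> tangent_space A p"
  obtains X where "X \<in> vector_fields A" "X p = v"
proof -
  obtain V \<psi> where V: "(V, \<psi>) \<in> A" "p \<in> V" using atlas_cover by blast
  interpret manifold_chart A V \<psi>
    by unfold_locales (rule smooth_chart_atlas[OF V(1)])
  obtain a where a: "v = (\<Sum>I\<in>UNIV. tscale (a I) (coord_vector A (V, \<psi>) I p))"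
    using tangent_space_coord[OF V(2) assms] .
  obtain r where r: "r > 0" "cball (\<psi> p) r \<subseteq> \<psi> ` V" using chart_cball[OF V(2)] .
  let ?X = "\<Sum>I\<in>UNIV. fscale (\<lambda>q. a I) (coord_bump p r I)"
  have "?X \<in> vector_fields A"
    by (intro vector_fields_sum vector_fields_fscale smooth_functions_const coord_bump_vector_field r)
  moreover have "?X p = v"
    by (simp add: a sum_fun_apply fscale_def coord_bump_center V r)
  ultimately show ?thesis using that by blast
qed

end

section \<open>The bracket on a para-Hermitian manifold\<close>

lemma tscale_one [simp]: "tscale 1 v = v"
  by (simp add: tscale_def)

lemma tscale_tscale [simp]: "tscale a (tscale b v) = tscale (a * b) v"
  by (simp add: tscale_def mult.assoc)

lemma tscale_zero [simp]: "tscale 0 v = 0" "tscale c 0 = 0"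
  by (simp_all add: tscale_def fun_eq_iff)

lemma tscale_add_right: "tscale a (v + w) = tscale a v + tscale a w"
  by (simp add: tscale_def fun_eq_iff distrib_left)

lemma diff_eq_tscale: "v - w = tscale 1 v + tscale (- 1) w"
  by (simp add: tscale_def fun_eq_iff)

locale para_hermitian_manifold =
  fixes A :: "('p::{t2_space, second_countable_topology}, 'n::finite + 'n) chart set"
    and \<eta> :: "'p metric" and K :: "'p endo"
  assumes para_hermitian: "para_hermitian A \<eta> K"
begin

lemma almost_para_hermitian: "almost_para_hermitian A \<eta> K"
  using para_hermitian by (simp add: para_hermitian_def)

sublocale manifold A
  using almost_para_hermitian by unfold_locales (simp add: almost_para_hermitian_def)

abbreviation "T \<equiv> tangent_space A"
abbreviation "VF \<equiv> vector_fields A"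
abbreviation "E \<equiv> eigenbundle A K"
abbreviation "ES \<equiv> eigensections A K"
abbreviation "ec \<equiv> eigencomponent K"

lemma pseudo_riemannian: "pseudo_riemannian A \<eta>"
  using almost_para_hermitian by (simp add: almost_para_hermitian_def)

lemma eta_lincomb:
  "u \<in> T p \<Longrightarrow> v \<in> T p \<Longrightarrow> w \<in> T p \<Longrightarrow> \<eta> p (tscale a u + tscale b v) w = a * \<eta> p u w + b * \<eta> p v w"
  using pseudo_riemannian by (simp add: pseudo_riemannian_def)

lemma eta_commute: "v \<in> T p \<Longrightarrow> w \<in> T p \<Longrightarrow> \<eta> p v w = \<eta> p w v"
  using pseudo_riemannian by (simp add: pseudo_riemannian_def)

lemma eta_nondegenerate: "v \<in> T p \<Longrightarrow> (\<And>w. w \<in> T p \<Longrightarrow> \<eta> p v w = 0) \<Longrightarrow> v = 0"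
  using pseudo_riemannian by (simp add: pseudo_riemannian_def)

lemma pair_smooth: "X \<in> VF \<Longrightarrow> Y \<in> VF \<Longrightarrow> pair \<eta> X Y \<in> smooth_functions A"
  using pseudo_riemannian by (simp add: pseudo_riemannian_def)

lemma eta_add_left: "u \<in> T p \<Longrightarrow> v \<in> T p \<Longrightarrow> w \<in> T p \<Longrightarrow> \<eta> p (u + v) w = \<eta> p u w + \<eta> p v w"
  using eta_lincomb[of u p v w 1 1] by simp

lemma eta_diff_left: "u \<in> T p \<Longrightarrow> v \<in> T p \<Longrightarrow> w \<in> T p \<Longrightarrow> \<eta> p (u - v) w = \<eta> p u w - \<eta> p v w"
  unfolding diff_eq_tscale using eta_lincomb[of u p v w 1 "-1"] by simp

lemma eta_tscale_left: "u \<in> T p \<Longrightarrow> w \<in> T p \<Longrightarrow> \<eta> p (tscale c u) w = c * \<eta> p u w"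
  using eta_lincomb[of u p u w c 0] by (simp add: tscale_def plus_fun_def)

lemma eta_zero_left: "w \<in> T p \<Longrightarrow> \<eta> p 0 w = 0"
  using eta_tscale_left[OF tangent_space_zero, of w p 0] by (simp add: tscale_def zero_fun_def)

lemma eta_add_right: "u \<in> T p \<Longrightarrow> v \<in> T p \<Longrightarrow> w \<in> T p \<Longrightarrow> \<eta> p w (u + v) = \<eta> p w u + \<eta> p w v"
  by (simp add: eta_commute[of w] eta_add_left tangent_space_add)

lemma eta_sum_left:
  assumes "w \<in> T p" "\<And>i. i \<in> I \<Longrightarrow> v i \<in> T p"
  shows "\<eta> p (\<Sum>i\<in>I. v i) w = (\<Sum>i\<in>I. \<eta> p (v i) w)"
  using assms(2)
proof (induction I rule: infinite_finite_induct)
  case (insert i I)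
  from insert have "\<eta> p (v i + (\<Sum>i\<in>I. v i)) w = \<eta> p (v i) w + \<eta> p (\<Sum>i\<in>I. v i) w"
    by (intro eta_add_left assms(1) tangent_space_sum) auto
  moreover have "\<eta> p (\<Sum>i\<in>I. v i) w = (\<Sum>i\<in>I. \<eta> p (v i) w)"
    using insert by blast
  ultimately show ?case by (simp only: sum.insert[OF insert(1,2)])
qed (simp_all add: eta_zero_left assms(1))

lemma endomorphism: "endomorphism A K"
  using almost_para_hermitian by (simp add: almost_para_hermitian_def)

lemma K_tangent: "v \<in> T p \<Longrightarrow> K p v \<in> T p"
  using endomorphism by (simp add: endomorphism_def)

lemma K_lincomb:
  "v \<in> T p \<Longrightarrow> w \<in> T p \<Longrightarrow> K p (tscale a v + tscale b w) = tscale a (K p v) + tscale b (K p w)"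
  using endomorphism by (simp add: endomorphism_def)

lemma K_K: "v \<in> T p \<Longrightarrow> K p (K p v) = v"
  using almost_para_hermitian by (simp add: almost_para_hermitian_def)

lemma eta_K: "v \<in> T p \<Longrightarrow> w \<in> T p \<Longrightarrow> \<eta> p (K p v) (K p w) = - \<eta> p v w"
  using almost_para_hermitian by (simp add: almost_para_hermitian_def)

lemma K_vector_field: "X \<in> VF \<Longrightarrow> (\<lambda>p. K p (X p)) \<in> VF"
  using endomorphism by (simp add: endomorphism_def)

lemma E_tangent: "v \<in> E s p \<Longrightarrow> v \<in> T p"
  by (simp add: eigenbundle_def)

lemma E_lincomb: "v \<in> E s p \<Longrightarrow> w \<in> E s p \<Longrightarrow> tscale a v + tscale b w \<in> E s p"
  by (auto simp: eigenbundle_def K_lincomb tangent_space_add tangent_space_tscale tscale_add_right mult.commute)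

lemma E_add: "v \<in> E s p \<Longrightarrow> w \<in> E s p \<Longrightarrow> v + w \<in> E s p"
  using E_lincomb[of v s p w 1 1] by simp

lemma E_diff: "v \<in> E s p \<Longrightarrow> w \<in> E s p \<Longrightarrow> v - w \<in> E s p"
  unfolding diff_eq_tscale by (rule E_lincomb)

lemma E_zero: "0 \<in> E s p"
  using K_lincomb[of 0 p 0 0 0] by (simp add: eigenbundle_def tangent_space_zero)

lemma E_isotropic:
  assumes s: "s \<in> {1, -1}" and v: "v \<in> E s p" and w: "w \<in> E s p"
  shows "\<eta> p v w = 0"
proof -
  have "- \<eta> p v w = \<eta> p (tscale s v) (tscale s w)"
    using v w eta_K[of v p w] by (simp add: eigenbundle_def)
  also have "\<dots> = s * (s * \<eta> p v w)"
    using v w by (simp add: E_tangent eta_tscale_left tangent_space_tscale eta_commute[of v p "tscale s w"]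
        eta_commute[of w])
  finally show ?thesis using s by auto
qed

lemma ES_VF: "X \<in> ES s \<Longrightarrow> X \<in> VF"
  by (simp add: eigensections_def)

lemma ES_E: "X \<in> ES s \<Longrightarrow> X p \<in> E s p"
  by (simp add: eigensections_def)

lemma ES_tangent: "X \<in> ES s \<Longrightarrow> X p \<in> T p"
  by (simp add: ES_VF vector_fieldsD)

lemma ES_diff: "X \<in> ES s \<Longrightarrow> Y \<in> ES s \<Longrightarrow> X - Y \<in> ES s"
  by (simp add: eigensections_def vector_fields_diff E_diff)

lemma ES_lie_bracket: "s \<in> {1, -1} \<Longrightarrow> X \<in> ES s \<Longrightarrow> Y \<in> ES s \<Longrightarrow> lie_bracket X Y \<in> ES s"
  using para_hermitian by (auto simp: para_hermitian_def frobenius_integrable_def)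

lemma ec_ES:
  assumes s: "s \<in> {1, -1}" and X: "X \<in> VF"
  shows "ec s X \<in> ES s"
proof -
  have eq: "ec s X p = tscale (1 / 2) (X p) + tscale (s / 2) (K p (X p))" for p
    by (simp add: eigencomponent_def tscale_add_right)
  have "ec s X = fscale (\<lambda>p. 1 / 2) X + fscale (\<lambda>p. s / 2) (\<lambda>p. K p (X p))"
    by (simp add: fun_eq_iff[of "ec s X"] eq fscale_def)
  then have "ec s X \<in> VF"
    by (simp add: vector_fields_add vector_fields_fscale smooth_functions_const X K_vector_field)
  moreover have "K p (ec s X p) = tscale s (ec s X p)" for p
    using vector_fieldsD[OF X, of p] s
    by (auto simp: eq K_lincomb K_tangent K_K tscale_add_right add.commute)
  ultimately show ?thesis by (simp add: eigensections_def eigenbundle_def vector_fieldsD)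
qed

lemma ec_decompose: "ec s X + ec (- s) X = X"
  by (simp add: fun_eq_iff eigencomponent_def tscale_def field_simps)

lemma ec_of_sum:
  assumes s: "s \<in> {1, -1}" and u: "u \<in> ES s" and w: "w \<in> ES (- s)"
  shows "ec s (u + w) = u" "ec (- s) (u + w) = w"
proof -
  have K: "K p (u p + w p) = tscale s (u p) + tscale (- s) (w p)" for p
    using K_lincomb[of "u p" p "w p" 1 1] ES_E[OF u, of p] ES_E[OF w, of p]
    by (simp add: eigenbundle_def)
  show "ec s (u + w) = u" "ec (- s) (u + w) = w"
    using s by (auto simp: fun_eq_iff eigencomponent_def K tscale_def field_simps)
qed

lemma pair_eq_zero_imp_zero:
  assumes s: "s \<in> {1, -1}" and X: "X \<in> ES (- s)" and pair: "\<And>z. z \<in> ES s \<Longrightarrow> pair \<eta> X z = 0"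
  shows "X = 0"
proof
  fix p
  show "X p = 0 p"
  proof (simp, rule eta_nondegenerate)
    show "X p \<in> T p" by (rule ES_tangent[OF X])
    fix v assume "v \<in> T p"
    then obtain Z where Z: "Z \<in> VF" "Z p = v" using vector_field_through by blast
    have s': "- s \<in> {1, -1}" using s by auto
    have "v = ec s Z p + ec (- s) Z p" using ec_decompose[of s Z] Z(2) by (metis plus_fun_apply)
    moreover have "\<eta> p (X p) (ec s Z p) = 0"
      using pair[OF ec_ES[OF s Z(1)]] by (simp add: pair_def fun_eq_iff)
    moreover have "\<eta> p (X p) (ec (- s) Z p) = 0"
      by (intro E_isotropic[OF s'] ES_E X ec_ES[OF s' Z(1)])
    ultimately show "\<eta> p (X p) v = 0"
      by (simp add: eta_add_right ES_tangent[OF X] ES_tangent[OF ec_ES[OF s Z(1)]] ES_tangent[OF ec_ES[OF s' Z(1)]])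
  qed
qed

lemma inj_on_rho:
  assumes s: "s \<in> {1, -1}"
  shows "inj_on (rho A \<eta> K s) VF"
proof (rule inj_onI)
  fix X Y assume X: "X \<in> VF" and Y: "Y \<in> VF" and eq: "rho A \<eta> K s X = rho A \<eta> K s Y"
  have s': "- s \<in> {1, -1}" using s by auto
  note X' = ec_ES[OF s' X] and Y' = ec_ES[OF s' Y]
  have "ec (- s) X - ec (- s) Y = 0"
  proof (rule pair_eq_zero_imp_zero[OF s ES_diff[OF X' Y']])
    fix z assume z: "z \<in> ES s"
    have "pair \<eta> (ec (- s) X) z = pair \<eta> (ec (- s) Y) z"
      using eq z by (auto simp: rho_def dest: fun_cong[where x = z])
    then show "pair \<eta> (ec (- s) X - ec (- s) Y) z = 0"
      by (simp add: pair_def fun_eq_iff eta_diff_left ES_tangent[OF X'] ES_tangent[OF Y'] ES_tangent[OF z])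
  qed
  moreover have "ec s X = ec s Y" using eq by (simp add: rho_def)
  ultimately show "X = Y" by (metis ec_decompose eq_iff_diff_eq_0)
qed

text \<open>The conditions on an adapted connection at the single point \<open>p\<close>; they also hold for the
  derivation of components in adapted coordinates, which is a connection on the chart domain only.\<close>
definition adapted_at :: "'p \<Rightarrow> ('p vfield \<Rightarrow> 'p vfield \<Rightarrow> 'p tangent) \<Rightarrow> bool" where
  "adapted_at p N \<longleftrightarrow>
     (\<forall>X\<in>VF. \<forall>Y\<in>VF. N X Y \<in> T p) \<and>
     (\<forall>X\<in>VF. \<forall>Y\<in>VF. \<forall>Z\<in>VF. N (X + Y) Z = N X Z + N Y Z \<and> N X (Y + Z) = N X Y + N X Z) \<and>
     (\<forall>s\<in>{1, -1}.
        (\<forall>x\<in>ES s. \<forall>Y\<in>VF. \<forall>Z\<in>VF. x p (pair \<eta> Y Z) = \<eta> p (N x Y) (Z p) + \<eta> p (Y p) (N x Z)) \<and>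
        (\<forall>x\<in>ES s. \<forall>y\<in>ES (-s). N x y \<in> E (-s) p) \<and>
        (\<forall>x\<in>ES s. \<forall>y\<in>ES s. \<forall>z\<in>ES (-s). \<eta> p (N x y - N y x - lie_bracket x y p) (z p) = 0) \<and>
        (\<forall>x\<in>ES s. \<forall>y\<in>ES s. \<forall>z\<in>ES s.
           \<eta> p (N x y - N y x - lie_bracket x y p) (z p) + \<eta> p (N z x) (y p) = 0))"

definition dorfman_pairing :: "real \<Rightarrow> 'p vfield \<Rightarrow> 'p vfield \<Rightarrow> 'p vfield \<Rightarrow> 'p \<Rightarrow> real" where
  "dorfman_pairing s X Y z p =
     ec s X p (pair \<eta> (ec (-s) Y) z) - \<eta> p (ec (-s) Y p) (lie_bracket (ec s X) z p)
     - ec s Y p (pair \<eta> (ec (-s) X) z) + \<eta> p (ec (-s) X p) (lie_bracket (ec s Y) z p)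
     + z p (pair \<eta> (ec (-s) X) (ec s Y))"

lemma adapted_at_bracket:
  assumes N: "adapted_at p N" and s: "s \<in> {1, -1}"
    and X: "X \<in> VF" and Y: "Y \<in> VF" and z: "z \<in> ES s"
  shows "\<eta> p (N X Y - N Y X) (z p) + \<eta> p (N z X) (Y p) =
    \<eta> p (lie_bracket (ec (-s) X) (ec (-s) Y) p) (z p) + dorfman_pairing s X Y z p"
proof -
  have s': "- s \<in> {1, -1}" using s by auto
  define a a' b b' where "a = ec s X" and "a' = ec (-s) X" and "b = ec s Y" and "b' = ec (-s) Y"
  have a: "a \<in> ES s" and b: "b \<in> ES s" and a': "a' \<in> ES (-s)" and b': "b' \<in> ES (-s)"
    using ec_ES[OF s X] ec_ES[OF s Y] ec_ES[OF s' X] ec_ES[OF s' Y]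
    by (simp_all add: a_def b_def a'_def b'_def)
  note VF = a[THEN ES_VF] b[THEN ES_VF] a'[THEN ES_VF] b'[THEN ES_VF] z[THEN ES_VF]
  note tan = VF[THEN vector_fieldsD]
  have XY: "X = a + a'" "Y = b + b'"
    by (simp_all add: a_def b_def a'_def b'_def ec_decompose)
  have NT: "N U V \<in> T p" if "U \<in> VF" "V \<in> VF" for U V
    using N that by (auto simp: adapted_at_def)
  have N_add: "N (U + V) W = N U W + N V W" "N W (U + V) = N W U + N W V"
    if "U \<in> VF" "V \<in> VF" "W \<in> VF" for U V W
    using N that by (auto simp: adapted_at_def)
  have LT: "lie_bracket U V p \<in> T p" if "U \<in> VF" "V \<in> VF" for U V
    by (simp add: vector_fieldsD vector_fields_lie_bracket that)
  note mem = NT LT tan VF tangent_space_add tangent_space_diff vector_fields_add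
  note lin = eta_add_left eta_diff_left eta_add_right
  have metric: "u p (pair \<eta> V W) = \<eta> p (N u V) (W p) + \<eta> p (V p) (N u W)"
    if "u \<in> ES t" "V \<in> VF" "W \<in> VF" "t \<in> {1, -1}" for u t V W
    using N that by (auto simp: adapted_at_def)
  have mixed: "N u w \<in> E (-t) p" if "u \<in> ES t" "w \<in> ES (-t)" "t \<in> {1, -1}" for u w t
    using N that by (auto simp: adapted_at_def)
  have torsion3: "\<eta> p (N u v) (w p) - \<eta> p (N v u) (w p) - \<eta> p (lie_bracket u v p) (w p) = 0"
    if "u \<in> ES t" "v \<in> ES t" "w \<in> ES (-t)" "t \<in> {1, -1}" for u v w t
  proof -
    note VF' = that(1)[THEN ES_VF] that(2)[THEN ES_VF] that(3)[THEN ES_VF]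
    have "\<eta> p (N u v - N v u - lie_bracket u v p) (w p) = 0"
      using N that by (auto simp: adapted_at_def)
    then show ?thesis
      by (simp add: eta_diff_left NT LT VF' VF'[THEN vector_fieldsD] tangent_space_diff)
  qed
  have "\<eta> p (N a b - N b a - lie_bracket a b p) (z p) + \<eta> p (N z a) (b p) = 0"
    using N s a b z by (auto simp: adapted_at_def)
  moreover have "\<eta> p (lie_bracket a b p) (z p) = 0"
    by (rule E_isotropic[OF s ES_E[OF ES_lie_bracket[OF s a b]] ES_E[OF z]])
  moreover have "\<eta> p (N a' b) (z p) = 0" "\<eta> p (N b' a) (z p) = 0"
    using mixed[OF a' _ s', of b] mixed[OF b' _ s', of a] a b
    by (auto intro!: E_isotropic[OF s _ ES_E[OF z]])
  moreover have "\<eta> p (N z a') (b' p) = 0"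
    by (rule E_isotropic[OF s' mixed[OF z a' s] ES_E[OF b']])
  moreover have "\<eta> p (N a' b') (z p) - \<eta> p (N b' a') (z p) - \<eta> p (lie_bracket a' b' p) (z p) = 0"
    using torsion3[OF a' b' _ s'] z by simp
  moreover note metric[OF a VF(4,5) s] metric[OF b VF(3,5) s] metric[OF z VF(3,2) s]
    torsion3[OF a z b' s] torsion3[OF b z a' s]
  ultimately have "\<eta> p (N X Y - N Y X) (z p) + \<eta> p (N z X) (Y p) =
      \<eta> p (lie_bracket a' b' p) (z p) + a p (pair \<eta> b' z) - \<eta> p (b' p) (lie_bracket a z p)
      - b p (pair \<eta> a' z) + \<eta> p (a' p) (lie_bracket b z p) + z p (pair \<eta> a' b)"
    unfolding XY
    by (simp add: N_add lin mem eta_commute[of "b' p"] eta_commute[of "a' p"])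
  then show ?thesis by (simp add: dorfman_pairing_def a_def b_def a'_def b'_def)
qed

lemma adapted_connection_adapted_at:
  assumes "adapted_connection A \<eta> K D"
  shows "adapted_at p (\<lambda>X Y. D X Y p)"
proof -
  have conn: "connection A D" using assms by (simp add: adapted_connection_def)
  have DT: "D X Y p \<in> T p" if "X \<in> VF" "Y \<in> VF" for X Y
    using conn that by (simp add: connection_def vector_fieldsD)
  have metric: "x p (pair \<eta> Y Z) = \<eta> p (D x Y p) (Z p) + \<eta> p (Y p) (D x Z p)"
    if "s \<in> {1, -1}" "x \<in> ES s" "Y \<in> VF" "Z \<in> VF" for s x Y Z
  proof -
    have "cov_metric \<eta> D x Y Z p = 0"
      using assms that by (auto simp: adapted_connection_def)
    then show ?thesis by (simp add: cov_metric_def vact_def pair_def)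
  qed
  have mixed: "D x y p \<in> E (-s) p" if "s \<in> {1, -1}" "x \<in> ES s" "y \<in> ES (-s)" for s x y
    using assms that ES_E[of _ "- s"] by (auto simp: adapted_connection_def)
  have torsion3: "\<eta> p (D x y p - D y x p - lie_bracket x y p) (z p) = 0"
    if "s \<in> {1, -1}" "x \<in> ES s" "y \<in> ES s" "z \<in> ES (-s)" for s x y z
  proof -
    have "pair \<eta> (torsion D x y) z p = 0"
      using assms that by (auto simp: adapted_connection_def)
    then show ?thesis by (simp add: pair_def torsion_def)
  qed
  have torsion4: "\<eta> p (D x y p - D y x p - lie_bracket x y p) (z p) + \<eta> p (D z x p) (y p) = 0"
    if "s \<in> {1, -1}" "x \<in> ES s" "y \<in> ES s" "z \<in> ES s" for s x y z
  proof -
    have "pair \<eta> (torsion D x y) z + pair \<eta> (D z x) y = 0"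
      using assms that unfolding adapted_connection_def by blast
    from fun_cong[OF this, of p] show ?thesis by (simp add: pair_def torsion_def)
  qed
  have add: "D (X + Y) Z p = D X Z p + D Y Z p" "D X (Y + Z) p = D X Y p + D X Z p"
    if "X \<in> VF" "Y \<in> VF" "Z \<in> VF" for X Y Z
    using conn that by (simp_all add: connection_def)
  show ?thesis
    unfolding adapted_at_def
    by (intro conjI ballI) (rule DT add metric mixed torsion3 torsion4; assumption)+
qed

lemma D_bracket_pairing:
  assumes "adapted_connection A \<eta> K D" and B: "D_bracket A \<eta> D B" and s: "s \<in> {1, -1}"
    and X: "X \<in> VF" and Y: "Y \<in> VF" and z: "z \<in> ES s"
  shows "\<eta> p (B X Y p) (z p) =
    \<eta> p (lie_bracket (ec (-s) X) (ec (-s) Y) p) (z p) + dorfman_pairing s X Y z p"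
proof -
  have "pair \<eta> (B X Y) z = pair \<eta> (D X Y - D Y X) z + pair \<eta> (D z X) Y"
    using B X Y ES_VF[OF z] by (simp add: D_bracket_def)
  then have "\<eta> p (B X Y p) (z p) = \<eta> p (D X Y p - D Y X p) (z p) + \<eta> p (D z X p) (Y p)"
    by (simp add: fun_eq_iff pair_def)
  then show ?thesis
    using adapted_at_bracket[OF adapted_connection_adapted_at[OF assms(1)] s X Y z, of p] by simp
qed

lemma dorfman_rho:
  assumes s: "s \<in> {1, -1}" and X: "X \<in> VF" and Y: "Y \<in> VF"
  shows "dorfman A K s (rho A \<eta> K s X) (rho A \<eta> K s Y) =
    (lie_bracket (ec s X) (ec s Y), \<lambda>z. if z \<in> ES s then dorfman_pairing s X Y z else 0)"
proof -
  note [simp] = ec_ES[OF s X] ec_ES[OF s Y] ES_lie_bracket[OF s]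
  show ?thesis
    by (auto simp: dorfman_def rho_def lie_form_def d_fun_def d_form_def fun_eq_iff vact_def
        dorfman_pairing_def) (auto simp: pair_def)
qed

lemma rho_inv_dorfman:
  assumes D: "adapted_connection A \<eta> K D" and B: "D_bracket A \<eta> D B" and s: "s \<in> {1, -1}"
    and X: "X \<in> VF" and Y: "Y \<in> VF"
  shows "rho_inv A \<eta> K s (dorfman A K s (rho A \<eta> K s X) (rho A \<eta> K s Y)) =
    lie_bracket (ec s X) (ec s Y) + (ec (-s) (B X Y) - lie_bracket (ec (-s) X) (ec (-s) Y))"
    (is "_ = ?u + ?w")
proof -
  have s': "- s \<in> {1, -1}" using s by auto
  have BXY: "B X Y \<in> VF" using B X Y by (simp add: D_bracket_def)
  note X' = ec_ES[OF s' X] and Y' = ec_ES[OF s' Y] and B' = ec_ES[OF s' BXY]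
  have u: "?u \<in> ES s" by (intro ES_lie_bracket s ec_ES X Y)
  have L: "lie_bracket (ec (-s) X) (ec (-s) Y) \<in> ES (-s)" by (rule ES_lie_bracket[OF s' X' Y'])
  have w: "?w \<in> ES (-s)" by (rule ES_diff[OF B' L])
  have "\<eta> p (?w p) (z p) = dorfman_pairing s X Y z p" if z: "z \<in> ES s" for z p
  proof -
    have "B X Y p = ec s (B X Y) p + ec (-s) (B X Y) p"
      using ec_decompose[of s "B X Y"] by (metis plus_fun_apply)
    then have "\<eta> p (B X Y p) (z p) = \<eta> p (ec (-s) (B X Y) p) (z p)"
      by (simp add: eta_add_left ES_tangent[OF ec_ES[OF s BXY]] ES_tangent[OF B'] ES_tangent[OF z]
          E_isotropic[OF s ES_E[OF ec_ES[OF s BXY]] ES_E[OF z]])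
    then show ?thesis
      using D_bracket_pairing[OF D B s X Y z, of p]
      by (simp add: eta_diff_left ES_tangent[OF B'] ES_tangent[OF L] ES_tangent[OF z])
  qed
  then have "(\<lambda>z. if z \<in> ES s then pair \<eta> ?w z else 0) =
      (\<lambda>z. if z \<in> ES s then dorfman_pairing s X Y z else 0)"
    by (auto simp: fun_eq_iff pair_def)
  then have "rho A \<eta> K s (?u + ?w) = dorfman A K s (rho A \<eta> K s X) (rho A \<eta> K s Y)"
    unfolding dorfman_rho[OF s X Y] by (simp only: rho_def ec_of_sum[OF s u w])
  then show ?thesis
    unfolding rho_inv_def
    by (rule the_inv_into_f_eq[OF inj_on_rho[OF s]])
       (intro vector_fields_add ES_VF[OF u] ES_VF[OF w])
qed

end

section \<open>Adapted coordinates\<close>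

fun dual_index :: "'n + 'n \<Rightarrow> 'n + 'n" where
  "dual_index (Inl i) = Inr i"
| "dual_index (Inr i) = Inl i"

lemma dual_index_dual_index [simp]: "dual_index (dual_index I) = I"
  by (cases I) auto

lemma sum_dual_index: "(\<Sum>I\<in>UNIV. f (dual_index I)) = (\<Sum>I\<in>UNIV. f (I :: 'n::finite + 'n))"
  by (rule sum.reindex_bij_witness[of _ dual_index dual_index]) auto

fun index_sign :: "'n + 'n \<Rightarrow> real" where
  "index_sign (Inl i) = 1"
| "index_sign (Inr i) = -1"

lemma index_sign_cases: "index_sign I \<in> {1, -1}"
  by (cases I) auto

lemma index_sign_dual_index: "index_sign (dual_index I) = - index_sign I"
  by (cases I) auto

locale adapted_coordinates = para_hermitian_manifold A \<eta> K
  for A :: "('p::{t2_space, second_countable_topology}, 'n::finite + 'n) chart set"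
    and \<eta> :: "'p metric" and K :: "'p endo" +
  fixes U :: "'p set" and \<phi> :: "'p \<Rightarrow> real ^ ('n + 'n)"
  assumes adapted_chart: "adapted_chart A \<eta> K (U, \<phi>)"
begin

sublocale manifold_chart A U \<phi>
  using adapted_chart by unfold_locales (simp add: adapted_chart_def)

abbreviation cc :: "'p vfield \<Rightarrow> 'p \<Rightarrow> real ^ ('n + 'n)" where
  "cc \<equiv> coord_components A (U, \<phi>)"

lemma coord_E:
  assumes p: "p \<in> U"
  shows "\<partial> I p \<in> E (index_sign I) p"
proof (cases I)
  case (Inl i)
  have "\<partial> (Inl i) p \<in> module.span tscale (range (\<lambda>i. \<partial> (Inl i) p))"
    by (intro module.span_base vector_space_tscale[folded module_iff_vector_space]) auto
  then show ?thesis using adapted_chart p Inl by (simp add: adapted_chart_def)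
next
  case (Inr i)
  have "\<partial> (Inr i) p \<in> module.span tscale (range (\<lambda>i. \<partial> (Inr i) p))"
    by (intro module.span_base vector_space_tscale[folded module_iff_vector_space]) auto
  then show ?thesis using adapted_chart p Inr by (simp add: adapted_chart_def)
qed

lemma eta_coord:
  assumes p: "p \<in> U"
  shows "\<eta> p (\<partial> I p) (\<partial> J p) = (if I = dual_index J then 1 else 0)"
proof -
  have lr: "\<eta> p (\<partial> (Inl i) p) (\<partial> (Inr j) p) = (if i = j then 1 else 0)"
      "\<eta> p (\<partial> (Inl i) p) (\<partial> (Inl j) p) = 0" "\<eta> p (\<partial> (Inr i) p) (\<partial> (Inr j) p) = 0" for i j
    using adapted_chart p by (auto simp: adapted_chart_def)
  have rl: "\<eta> p (\<partial> (Inr i) p) (\<partial> (Inl j) p) = (if i = j then 1 else 0)" for i j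
    using lr(1)[of j i] eta_commute[OF coord_in_tangent_space[OF p] coord_in_tangent_space[OF p], of "Inr i" "Inl j"]
    by auto
  show ?thesis by (cases I; cases J) (simp_all add: lr rl)
qed

lemma eta_coord_sum:
  assumes p: "p \<in> U"
  shows "\<eta> p (\<Sum>I\<in>UNIV. tscale (a I) (\<partial> I p)) (\<partial> J p) = a (dual_index J)"
proof -
  have "\<eta> p (\<Sum>I\<in>UNIV. tscale (a I) (\<partial> I p)) (\<partial> J p) = (\<Sum>I\<in>UNIV. a I * (if I = dual_index J then 1 else 0))"
    by (subst eta_sum_left) (simp_all add: p coord_in_tangent_space tangent_space_tscale eta_tscale_left eta_coord)
  then show ?thesis by (simp add: if_distrib[of "(*) _"] cong: if_cong)
qed

lemma coord_sum_tangent: "p \<in> U \<Longrightarrow> (\<Sum>I\<in>UNIV. tscale (a I) (\<partial> I p)) \<in> T p"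
  by (intro tangent_space_sum tangent_space_tscale coord_in_tangent_space)

lemma tangent_eq_coord_sum:
  assumes p: "p \<in> U" and v: "v \<in> T p"
  shows "v = (\<Sum>I\<in>UNIV. tscale (\<eta> p v (\<partial> (dual_index I) p)) (\<partial> I p))"
proof -
  obtain a where a: "v = (\<Sum>I\<in>UNIV. tscale (a I) (\<partial> I p))"
    using tangent_space_coord[OF p v] .
  have "\<eta> p v (\<partial> (dual_index I) p) = a I" for I
    unfolding a eta_coord_sum[OF p] by simp
  then show ?thesis using a by simp
qed

lemma coord_components_eta:
  assumes p: "p \<in> U" and v: "X p \<in> T p"
  shows "cc X p $ I = \<eta> p (X p) (\<partial> (dual_index I) p)"
proof -
  have "cc X p = (\<chi> I. \<eta> p (X p) (\<partial> (dual_index I) p))"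
    unfolding coord_components_def
  proof (rule the_equality)
    show "X p = (\<Sum>I\<in>UNIV. tscale ((\<chi> I. \<eta> p (X p) (\<partial> (dual_index I) p)) $ I) (\<partial> I p))"
      using tangent_eq_coord_sum[OF p v] by simp
  next
    fix a assume a: "X p = (\<Sum>I\<in>UNIV. tscale (a $ I) (\<partial> I p))"
    have "\<eta> p (X p) (\<partial> (dual_index I) p) = a $ I" for I
      unfolding a eta_coord_sum[OF p] by simp
    then show "a = (\<chi> I. \<eta> p (X p) (\<partial> (dual_index I) p))" by (simp add: vec_eq_iff)
  qed
  then show ?thesis by simp
qed

lemma coord_components_sum:
  assumes p: "p \<in> U" and X: "X \<in> VF"
  shows "X p = (\<Sum>I\<in>UNIV. tscale (cc X p $ I) (\<partial> I p))"
  using tangent_eq_coord_sum[OF p vector_fieldsD[OF X]]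
  by (simp add: coord_components_eta[of p X] p vector_fieldsD[OF X])

lemma eta_coord_sum_field:
  assumes p: "p \<in> U" and Z: "Z \<in> VF"
  shows "\<eta> p (\<Sum>I\<in>UNIV. tscale (a I) (\<partial> I p)) (Z p) = (\<Sum>I\<in>UNIV. a I * cc Z p $ dual_index I)"
proof -
  have "\<eta> p (\<Sum>I\<in>UNIV. tscale (a I) (\<partial> I p)) (Z p) = (\<Sum>I\<in>UNIV. a I * \<eta> p (\<partial> I p) (Z p))"
    by (subst eta_sum_left)
       (simp_all add: p coord_in_tangent_space tangent_space_tscale eta_tscale_left vector_fieldsD[OF Z])
  then show ?thesis
    by (simp add: coord_components_eta p vector_fieldsD[OF Z] eta_commute[OF vector_fieldsD[OF Z] coord_in_tangent_space[OF p]])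
qed

lemma eta_components:
  assumes p: "p \<in> U" and Y: "Y \<in> VF" and Z: "Z \<in> VF"
  shows "\<eta> p (Y p) (Z p) = (\<Sum>I\<in>UNIV. cc Y p $ I * cc Z p $ dual_index I)"
  by (subst (1) coord_components_sum[OF p Y]) (rule eta_coord_sum_field[OF p Z])

lemma field_apply:
  assumes p: "p \<in> U" and X: "X \<in> VF" and f: "f \<in> smooth_functions A"
  shows "X p f = (\<Sum>I\<in>UNIV. cc X p $ I * pd I f p)"
  by (subst (1) coord_components_sum[OF p X]) (simp add: sum_fun_apply tscale_def coord_smooth f)

lemma components_differentiable:
  assumes p: "p \<in> U" and X: "X \<in> VF"
  shows "(\<lambda>y. cc X (inv_into U \<phi> y) $ I) differentiable at (\<phi> p)"
proof -
  obtain r where r: "r > 0" "cball (\<phi> p) r \<subseteq> \<phi> ` U" using chart_cball[OF p] .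
  let ?Z = "coord_bump p r (dual_index I)"
  let ?f = "\<lambda>y. pair \<eta> X ?Z (inv_into U \<phi> y)"
  have Z: "?Z \<in> VF" by (rule coord_bump_vector_field[OF r])
  have f: "?f differentiable at (\<phi> p)"
    by (rule chart_differentiable[OF pair_smooth[OF X Z] p])
  have b: "bump (\<phi> p) r differentiable at (\<phi> p)"
    using smooth_on_has_derivative[OF open_UNIV smooth_bump] by (auto simp: differentiable_def)
  have eq: "?f y / bump (\<phi> p) r y = cc X (inv_into U \<phi> y) $ I" if y: "y \<in> ball (\<phi> p) r" for y
  proof -
    have "y \<in> \<phi> ` U" using y r by auto
    then obtain q where q: "q \<in> U" "y = \<phi> q" by auto
    note t = vector_fieldsD[OF X, of q]
    have "?f y = bump (\<phi> p) r y * \<eta> q (X q) (\<partial> (dual_index I) q)"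
      using q by (simp add: pair_def coord_bump_def fscale_def bump_at_def extension_def
          eta_commute[OF t] tangent_space_tscale coord_in_tangent_space eta_tscale_left t)
    then show ?thesis
      using q bump_pos[OF y] coord_components_eta[of q X, OF q(1) t] by simp
  qed
  have "(\<lambda>y. ?f y / bump (\<phi> p) r y) differentiable at (\<phi> p)"
    by (rule differentiable_divide[OF f b]) (simp add: r)
  then show ?thesis
    unfolding differentiable_def
    by (metis (no_types, lifting) has_derivative_transform_within_open[OF _ open_ball] eq centre_in_ball r(1))
qed

lemma pd_cong:
  assumes "p \<in> U" "\<And>q. q \<in> U \<Longrightarrow> f q = g q" "(\<lambda>y. f (inv_into U \<phi> y)) differentiable at (\<phi> p)"
  shows "pd I f p = pd I g p"
  unfolding pd_eq
  by (rule fun_cong[OF frechet_derivative_transform_within_open[OF assms(3) open_range]])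
     (use assms(1,2) in \<open>auto simp: inv_into_into\<close>)

lemma pd_sum_mult:
  assumes p: "p \<in> U"
    and "\<And>J. J \<in> M \<Longrightarrow> (\<lambda>y. f J (inv_into U \<phi> y)) differentiable at (\<phi> p)"
    and "\<And>J. J \<in> M \<Longrightarrow> (\<lambda>y. g J (inv_into U \<phi> y)) differentiable at (\<phi> p)"
    and h: "\<And>q. q \<in> U \<Longrightarrow> (\<Sum>J\<in>M. f J q * g J q) = h q"
  shows "pd I h p = (\<Sum>J\<in>M. f J p * pd I (g J) p + pd I (f J) p * g J p)"
proof -
  have "((\<lambda>y. \<Sum>J\<in>M. f J (inv_into U \<phi> y) * g J (inv_into U \<phi> y)) has_derivative
    (\<lambda>v. \<Sum>J\<in>M. f J (inv_into U \<phi> (\<phi> p)) * frechet_derivative (\<lambda>y. g J (inv_into U \<phi> y)) (at (\<phi> p)) v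
       + frechet_derivative (\<lambda>y. f J (inv_into U \<phi> y)) (at (\<phi> p)) v * g J (inv_into U \<phi> (\<phi> p)))) (at (\<phi> p))"
    using assms(2,3) unfolding frechet_derivative_works by (intro has_derivative_sum has_derivative_mult) auto
  then have "((\<lambda>y. h (inv_into U \<phi> y)) has_derivative
    (\<lambda>v. \<Sum>J\<in>M. f J (inv_into U \<phi> (\<phi> p)) * frechet_derivative (\<lambda>y. g J (inv_into U \<phi> y)) (at (\<phi> p)) v
       + frechet_derivative (\<lambda>y. f J (inv_into U \<phi> y)) (at (\<phi> p)) v * g J (inv_into U \<phi> (\<phi> p)))) (at (\<phi> p))"
    by (rule has_derivative_transform_within_open[OF _ open_range]) (use p h in \<open>auto simp: inv_into_into\<close>)
  from pd_eqI[OF this] show ?thesis using p by (simp add: pd_eq)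
qed

definition flat_deriv :: "'p \<Rightarrow> 'p vfield \<Rightarrow> 'p vfield \<Rightarrow> 'p tangent" where
  "flat_deriv p X Y = (\<Sum>J\<in>UNIV. tscale (\<Sum>I\<in>UNIV. cc X p $ I * pd I (\<lambda>q. cc Y q $ J) p) (\<partial> J p))"

lemma components_add:
  assumes p: "p \<in> U" and "X \<in> VF" "Y \<in> VF"
  shows "cc (X + Y) p $ I = cc X p $ I + cc Y p $ I"
  using assms
  by (simp add: coord_components_eta vector_fieldsD vector_fields_add eta_add_left tangent_space_add coord_in_tangent_space)

lemma flat_deriv_add:
  assumes p: "p \<in> U" and X: "X \<in> VF" and Y: "Y \<in> VF" and Z: "Z \<in> VF"
  shows "flat_deriv p (X + Y) Z = flat_deriv p X Z + flat_deriv p Y Z"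
    and "flat_deriv p X (Y + Z) = flat_deriv p X Y + flat_deriv p X Z"
proof -
  show "flat_deriv p (X + Y) Z = flat_deriv p X Z + flat_deriv p Y Z"
    by (simp add: flat_deriv_def fun_eq_iff sum_fun_apply tscale_def components_add p X Y
        distrib_right sum.distrib)
  have "pd I (\<lambda>q. cc (Y + Z) q $ J) p = pd I (\<lambda>q. cc Y q $ J) p + pd I (\<lambda>q. cc Z q $ J) p" for I J
  proof -
    note dY = components_differentiable[OF p Y, of J, unfolded frechet_derivative_works]
      and dZ = components_differentiable[OF p Z, of J, unfolded frechet_derivative_works]
    have "((\<lambda>y. cc (Y + Z) (inv_into U \<phi> y) $ J) has_derivative
       (\<lambda>v. frechet_derivative (\<lambda>y. cc Y (inv_into U \<phi> y) $ J) (at (\<phi> p)) v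
          + frechet_derivative (\<lambda>y. cc Z (inv_into U \<phi> y) $ J) (at (\<phi> p)) v)) (at (\<phi> p))"
      by (rule has_derivative_transform_within_open[OF has_derivative_add[OF dY dZ] open_range])
         (use p Y Z in \<open>auto simp: components_add inv_into_into\<close>)
    from pd_eqI[OF this, of I] show ?thesis by (simp only: pd_eq)
  qed
  then show "flat_deriv p X (Y + Z) = flat_deriv p X Y + flat_deriv p X Z"
    by (simp add: flat_deriv_def fun_eq_iff sum_fun_apply tscale_def
        distrib_left distrib_right sum.distrib)
qed

lemma flat_deriv_metric:
  assumes p: "p \<in> U" and X: "X \<in> VF" and Y: "Y \<in> VF" and Z: "Z \<in> VF"
  shows "X p (pair \<eta> Y Z) = \<eta> p (flat_deriv p X Y) (Z p) + \<eta> p (Y p) (flat_deriv p X Z)"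
proof -
  have "pd I (pair \<eta> Y Z) p = (\<Sum>J\<in>UNIV. cc Y p $ J * pd I (\<lambda>q. cc Z q $ dual_index J) p
      + pd I (\<lambda>q. cc Y q $ J) p * cc Z p $ dual_index J)" for I
    by (rule pd_sum_mult[OF p])
       (simp_all add: components_differentiable p Y Z pair_def eta_components)
  then have "X p (pair \<eta> Y Z) = (\<Sum>I\<in>UNIV. \<Sum>J\<in>UNIV. cc X p $ I * (cc Y p $ J * pd I (\<lambda>q. cc Z q $ dual_index J) p))
      + (\<Sum>I\<in>UNIV. \<Sum>J\<in>UNIV. cc X p $ I * (pd I (\<lambda>q. cc Y q $ J) p * cc Z p $ dual_index J))"
    by (simp add: field_apply p X pair_smooth Y Z sum_distrib_left distrib_left sum.distrib)
  moreover have "\<eta> p (flat_deriv p X Y) (Z p) =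
      (\<Sum>I\<in>UNIV. \<Sum>J\<in>UNIV. cc X p $ I * (pd I (\<lambda>q. cc Y q $ J) p * cc Z p $ dual_index J))"
    unfolding flat_deriv_def eta_coord_sum_field[OF p Z] sum_distrib_right
    by (subst sum.swap) (simp add: mult.assoc)
  moreover have "\<eta> p (Y p) (flat_deriv p X Z) =
      (\<Sum>I\<in>UNIV. \<Sum>J\<in>UNIV. cc X p $ I * (cc Y p $ J * pd I (\<lambda>q. cc Z q $ dual_index J) p))"
  proof -
    have "\<eta> p (Y p) (flat_deriv p X Z) = \<eta> p (flat_deriv p X Z) (Y p)"
      by (simp add: eta_commute vector_fieldsD[OF Y] flat_deriv_def coord_sum_tangent p)
    also have "\<dots> = (\<Sum>J\<in>UNIV. (\<Sum>I\<in>UNIV. cc X p $ I * pd I (\<lambda>q. cc Z q $ J) p) * cc Y p $ dual_index J)"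
      unfolding flat_deriv_def eta_coord_sum_field[OF p Y] ..
    also have "\<dots> = (\<Sum>J\<in>UNIV. (\<Sum>I\<in>UNIV. cc X p $ I * pd I (\<lambda>q. cc Z q $ dual_index J) p) * cc Y p $ J)"
      by (subst sum_dual_index[symmetric]) simp
    also have "\<dots> = (\<Sum>I\<in>UNIV. \<Sum>J\<in>UNIV. cc X p $ I * (cc Y p $ J * pd I (\<lambda>q. cc Z q $ dual_index J) p))"
      unfolding sum_distrib_right by (subst sum.swap) (simp add: mult_ac)
    finally show ?thesis .
  qed
  ultimately show ?thesis by simp
qed

lemma pd_pd_commute:
  assumes p: "p \<in> U" and f: "f \<in> smooth_functions A"
  shows "(\<lambda>y. pd J f (inv_into U \<phi> y)) differentiable at (\<phi> p)"
    and "pd I (pd J f) p = pd J (pd I f) p"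
proof -
  let ?f = "\<lambda>y. f (inv_into U \<phi> y)"
  note sf = smooth_function_chart[OF f]
  have der: "((\<lambda>y. pd J f (inv_into U \<phi> y)) has_derivative
      frechet_derivative (\<lambda>x. frechet_derivative ?f (at x) (axis J 1)) (at (\<phi> p))) (at (\<phi> p))" for J
    by (rule has_derivative_transform_within_open[OF smooth_on_has_derivative[OF open_range
          smooth_on_frechet_derivative[OF sf]] open_range])
       (use p in \<open>auto simp: pd_eq axis_in_Basis_iff\<close>)
  show "(\<lambda>y. pd J f (inv_into U \<phi> y)) differentiable at (\<phi> p)"
    using der by (auto simp: differentiable_def)
  show "pd I (pd J f) p = pd J (pd I f) p"
    unfolding pd_eqI[OF der]
    by (rule frechet_derivative_commute[OF open_range _ sf]) (use p in \<open>auto simp: axis_in_Basis_iff\<close>)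
qed

lemma flat_deriv_torsion_free:
  assumes p: "p \<in> U" and X: "X \<in> VF" and Y: "Y \<in> VF"
  shows "lie_bracket X Y p = flat_deriv p X Y - flat_deriv p Y X"
proof
  fix f
  show "lie_bracket X Y p f = (flat_deriv p X Y - flat_deriv p Y X) f"
  proof (cases "f \<in> smooth_functions A")
    case f: True
    have vact: "V p (vact W f) = (\<Sum>I\<in>UNIV. \<Sum>J\<in>UNIV. cc V p $ I * cc W p $ J * pd I (pd J f) p)
        + flat_deriv p V W f" if V: "V \<in> VF" and W: "W \<in> VF" for V W
    proof -
      have "pd I (vact W f) p = (\<Sum>J\<in>UNIV. cc W p $ J * pd I (pd J f) p + pd I (\<lambda>q. cc W q $ J) p * pd J f p)" for I
        by (rule pd_sum_mult[OF p])
           (simp_all add: components_differentiable pd_pd_commute(1) p W f vact_def field_apply)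
      then have "V p (vact W f) = (\<Sum>I\<in>UNIV. \<Sum>J\<in>UNIV. cc V p $ I * cc W p $ J * pd I (pd J f) p)
          + (\<Sum>I\<in>UNIV. \<Sum>J\<in>UNIV. cc V p $ I * pd I (\<lambda>q. cc W q $ J) p * pd J f p)"
        by (simp add: field_apply p V vact_smooth W f sum_distrib_left distrib_left sum.distrib mult.assoc)
      also have "(\<Sum>I\<in>UNIV. \<Sum>J\<in>UNIV. cc V p $ I * pd I (\<lambda>q. cc W q $ J) p * pd J f p) = flat_deriv p V W f"
        by (subst sum.swap) (simp add: flat_deriv_def sum_fun_apply tscale_def coord_smooth f sum_distrib_right)
      finally show ?thesis .
    qed
    have "(\<Sum>I\<in>UNIV. \<Sum>J\<in>UNIV. cc X p $ I * cc Y p $ J * pd I (pd J f) p) =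
        (\<Sum>I\<in>UNIV. \<Sum>J\<in>UNIV. cc Y p $ I * cc X p $ J * pd I (pd J f) p)"
      by (subst sum.swap) (intro sum.cong refl, subst pd_pd_commute(2)[OF p f], simp)
    then show ?thesis
      by (simp add: lie_bracket_def vact[OF X Y] vact[OF Y X])
  next
    case False
    then show ?thesis
      by (simp add: tangent_nonsmooth[OF vector_fieldsD[OF vector_fields_lie_bracket[OF X Y]]]
          tangent_nonsmooth[OF coord_sum_tangent[OF p]] flat_deriv_def)
  qed
qed

lemma flat_deriv_E:
  assumes p: "p \<in> U" and s: "s \<in> {1, -1}" and Y: "Y \<in> ES s"
  shows "flat_deriv p X Y \<in> E s p"
proof -
  have zero: "cc Y q $ J = 0" if "q \<in> U" "index_sign J \<noteq> s" for q J
  proof -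
    have "index_sign (dual_index J) = s"
      using that(2) s index_sign_cases[of J] by (auto simp: index_sign_dual_index)
    then show ?thesis
      using coord_components_eta[of q Y, OF that(1) ES_tangent[OF Y]]
        E_isotropic[OF s ES_E[OF Y, of q], of "\<partial> (dual_index J) q"]
        coord_E[OF that(1), of "dual_index J"] by simp
  qed
  have "tscale (\<Sum>I\<in>UNIV. cc X p $ I * pd I (\<lambda>q. cc Y q $ J) p) (\<partial> J p) \<in> E s p" for J
  proof (cases "index_sign J = s")
    case True
    then show ?thesis
      using E_lincomb[OF coord_E[OF p] coord_E[OF p], of _ J 0] by (simp add: tscale_def plus_fun_def)
  next
    case False
    have "pd I (\<lambda>q. cc Y q $ J) p = 0" for I
    proof -
      have "pd I (\<lambda>q. 0) p = pd I (\<lambda>q. cc Y q $ J) p"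
        by (rule pd_cong[OF p]) (simp_all add: zero False)
      then show ?thesis by (simp add: pd_eq)
    qed
    then show ?thesis using E_zero by (simp add: tscale_def zero_fun_def)
  qed
  then have "(\<Sum>J\<in>M. tscale (\<Sum>I\<in>UNIV. cc X p $ I * pd I (\<lambda>q. cc Y q $ J) p) (\<partial> J p)) \<in> E s p" for M
    by (induction M rule: infinite_finite_induct) (simp_all add: E_zero E_add)
  then show ?thesis by (simp add: flat_deriv_def)
qed

lemma adapted_at_flat_deriv:
  assumes p: "p \<in> U"
  shows "adapted_at p (flat_deriv p)"
proof -
  have tangent: "flat_deriv p X Y \<in> T p" for X Y
    by (simp add: flat_deriv_def coord_sum_tangent p)
  have metric: "x p (pair \<eta> Y Z) = \<eta> p (flat_deriv p x Y) (Z p) + \<eta> p (Y p) (flat_deriv p x Z)"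
    if "x \<in> ES s" "Y \<in> VF" "Z \<in> VF" for s x Y Z
    by (rule flat_deriv_metric[OF p ES_VF[OF that(1)] that(2,3)])
  have mixed: "flat_deriv p x y \<in> E (-s) p" if "s \<in> {1, -1}" "y \<in> ES (-s)" for s x y
    by (rule flat_deriv_E[OF p _ that(2)]) (use that in auto)
  have torsion: "\<eta> p (flat_deriv p x y - flat_deriv p y x - lie_bracket x y p) (z p) = 0"
    if "x \<in> ES s" "y \<in> ES s" "z \<in> ES t" for s t x y z
    using that by (simp add: flat_deriv_torsion_free p ES_VF eta_zero_left ES_tangent)
  have torsion4: "\<eta> p (flat_deriv p x y - flat_deriv p y x - lie_bracket x y p) (z p)
      + \<eta> p (flat_deriv p z x) (y p) = 0"
    if "s \<in> {1, -1}" "x \<in> ES s" "y \<in> ES s" "z \<in> ES s" for s x y z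
    using torsion[OF that(2-4)] E_isotropic[OF that(1) flat_deriv_E[OF p that(1,2)] ES_E[OF that(3)]] by simp
  show ?thesis
    unfolding adapted_at_def
    by (intro conjI ballI) (rule tangent flat_deriv_add[OF p] metric mixed torsion torsion4; assumption)+
qed

lemma metric_matrix_component:
  "p \<in> U \<Longrightarrow> metric_matrix A \<eta> (U, \<phi>) p $ I $ J = (if J = dual_index I then 1 else 0)"
  by (auto simp: metric_matrix_def eta_coord)

lemma matrix_inv_metric_matrix:
  assumes p: "p \<in> U"
  shows "matrix_inv (metric_matrix A \<eta> (U, \<phi>) p) = metric_matrix A \<eta> (U, \<phi>) p"
proof -
  let ?G = "metric_matrix A \<eta> (U, \<phi>) p"
  have GG: "?G ** ?G = mat 1"
    by (simp add: matrix_matrix_mult_def mat_def vec_eq_iff metric_matrix_component p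
        if_distrib[of "\<lambda>x. x * _"] eq_commute cong: if_cong)
  then have "?G ** matrix_inv ?G = mat 1"
    unfolding matrix_inv_def by (metis (mono_tags, lifting) someI_ex)
  then have "?G ** (?G ** matrix_inv ?G) = ?G" by simp
  then show ?thesis by (simp add: matrix_mul_assoc GG)
qed

lemma section_through_coord:
  assumes p: "p \<in> U"
  obtains z where "z \<in> ES (index_sign M)" "z p = \<partial> M p"
proof -
  obtain Z where Z: "Z \<in> VF" "Z p = \<partial> M p"
    using vector_field_through[OF coord_in_tangent_space[OF p]] .
  have "K p (\<partial> M p) = tscale (index_sign M) (\<partial> M p)"
    using coord_E[OF p, of M] by (simp add: eigenbundle_def)
  then have "ec (index_sign M) Z p = \<partial> M p"
    using index_sign_cases[of M]
    by (auto simp: eigencomponent_def Z(2)) (auto simp: tscale_def fun_eq_iff)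
  then show ?thesis using that ec_ES[OF index_sign_cases Z(1)] by blast
qed

lemma D_bracket_coordinates:
  assumes D: "adapted_connection A \<eta> K D" and B: "D_bracket A \<eta> D B"
    and X: "X \<in> VF" and Y: "Y \<in> VF" and p: "p \<in> U"
  shows "B X Y p =
    (\<Sum>J\<in>UNIV. tscale
       ((\<Sum>I\<in>UNIV. cc X p $ I * pd I (\<lambda>q. cc Y q $ J) p)
        - (\<Sum>I\<in>UNIV. cc Y p $ I * pd I (\<lambda>q. cc X q $ J) p)
        + (\<Sum>I\<in>UNIV. \<Sum>L\<in>UNIV. \<Sum>M\<in>UNIV.
             metric_matrix A \<eta> (U, \<phi>) p $ I $ L * matrix_inv (metric_matrix A \<eta> (U, \<phi>) p) $ M $ J
             * cc Y p $ I * pd M (\<lambda>q. cc X q $ L) p))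
       (\<partial> J p))"
    (is "_ = (\<Sum>J\<in>UNIV. tscale (?c J) (\<partial> J p))")
proof -
  have BXY: "B X Y \<in> VF" using B X Y by (simp add: D_bracket_def)
  have "\<eta> p (B X Y p) (\<partial> (dual_index J) p) = ?c J" for J
  proof -
    let ?M = "dual_index J"
    let ?s = "index_sign ?M"
    obtain z where z: "z \<in> ES ?s" "z p = \<partial> ?M p" using section_through_coord[OF p] .
    have "\<eta> p (B X Y p) (\<partial> ?M p) =
        \<eta> p (flat_deriv p X Y - flat_deriv p Y X) (\<partial> ?M p) + \<eta> p (flat_deriv p z X) (Y p)"
      using D_bracket_pairing[OF D B index_sign_cases X Y z(1), of p]
        adapted_at_bracket[OF adapted_at_flat_deriv[OF p] index_sign_cases X Y z(1)] z(2) by simp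
    also have "\<eta> p (flat_deriv p X Y - flat_deriv p Y X) (\<partial> ?M p) =
        (\<Sum>I\<in>UNIV. cc X p $ I * pd I (\<lambda>q. cc Y q $ J) p) - (\<Sum>I\<in>UNIV. cc Y p $ I * pd I (\<lambda>q. cc X q $ J) p)"
      by (simp add: flat_deriv_def eta_diff_left coord_sum_tangent coord_in_tangent_space p eta_coord_sum)
    also have "\<eta> p (flat_deriv p z X) (Y p) = (\<Sum>L\<in>UNIV. pd ?M (\<lambda>q. cc X q $ L) p * cc Y p $ dual_index L)"
    proof -
      have "cc z p $ I = (if I = ?M then 1 else 0)" for I
        using coord_components_eta[of p z I, OF p ES_tangent[OF z(1)]] z(2) p by (auto simp: eta_coord)
      then show ?thesis
        by (simp add: flat_deriv_def eta_coord_sum_field[OF p Y] if_distrib[of "\<lambda>x. x * _"] cong: if_cong)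
    qed
    also have "\<dots> = (\<Sum>I\<in>UNIV. cc Y p $ I * pd ?M (\<lambda>q. cc X q $ dual_index I) p)"
      by (subst sum_dual_index[symmetric]) (simp add: mult.commute)
    also have "\<dots> = (\<Sum>I\<in>UNIV. \<Sum>L\<in>UNIV. \<Sum>M\<in>UNIV.
        (if L = dual_index I then if M = ?M then cc Y p $ I * pd M (\<lambda>q. cc X q $ L) p else 0 else 0))"
      by (simp add: sum.If_cases if_distrib[of "\<lambda>f. sum f UNIV"])
    also have "\<dots> = (\<Sum>I\<in>UNIV. \<Sum>L\<in>UNIV. \<Sum>M\<in>UNIV.
        metric_matrix A \<eta> (U, \<phi>) p $ I $ L * matrix_inv (metric_matrix A \<eta> (U, \<phi>) p) $ M $ J
        * cc Y p $ I * pd M (\<lambda>q. cc X q $ L) p)"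
      by (intro sum.cong refl)
         (auto simp: matrix_inv_metric_matrix[OF p] metric_matrix_component p)
    finally show ?thesis by simp
  qed
  then show ?thesis using tangent_eq_coord_sum[OF p vector_fieldsD[OF BXY]] by simp
qed

end

theorem corollary4p6:
  fixes A :: "('p::{t2_space, second_countable_topology}, 'n::finite + 'n) chart set"
    and \<eta> :: "'p metric" and K :: "'p endo" and D :: "'p conn"
    and B :: "'p vfield \<Rightarrow> 'p vfield \<Rightarrow> 'p vfield"
  assumes "para_hermitian A \<eta> K"
    and "adapted_connection A \<eta> K D"
    and "D_bracket A \<eta> D B"
  shows "(\<forall>X\<in>vector_fields A. \<forall>Y\<in>vector_fields A.
            B X Y = rho_inv A \<eta> K 1 (dorfman A K 1 (rho A \<eta> K 1 X) (rho A \<eta> K 1 Y))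
                  + rho_inv A \<eta> K (-1) (dorfman A K (-1) (rho A \<eta> K (-1) X) (rho A \<eta> K (-1) Y)))
       \<and> (flat_metric A \<eta> \<longrightarrow>
           (\<forall>c. adapted_chart A \<eta> K c \<longrightarrow>
             (\<forall>X\<in>vector_fields A. \<forall>Y\<in>vector_fields A. \<forall>p\<in>fst c.
               B X Y p =
                 (\<Sum>J\<in>UNIV. tscale
                    ((\<Sum>I\<in>UNIV. coord_components A c X p $ I * partial_deriv c I (\<lambda>q. coord_components A c Y q $ J) p)
                     - (\<Sum>I\<in>UNIV. coord_components A c Y p $ I * partial_deriv c I (\<lambda>q. coord_components A c X q $ J) p)
                     + (\<Sum>I\<in>UNIV. \<Sum>L\<in>UNIV. \<Sum>M\<in>UNIV.
                          metric_matrix A \<eta> c p $ I $ L * matrix_inv (metric_matrix A \<eta> c p) $ M $ J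
                          * coord_components A c Y p $ I * partial_deriv c M (\<lambda>q. coord_components A c X q $ L) p))
                    (coord_vector A c J p)))))"
proof (intro conjI ballI impI allI)
  interpret para_hermitian_manifold A \<eta> K
    by unfold_locales (rule assms(1))
  fix X Y assume XY: "X \<in> vector_fields A" "Y \<in> vector_fields A"
  show "B X Y = rho_inv A \<eta> K 1 (dorfman A K 1 (rho A \<eta> K 1 X) (rho A \<eta> K 1 Y))
      + rho_inv A \<eta> K (-1) (dorfman A K (-1) (rho A \<eta> K (-1) X) (rho A \<eta> K (-1) Y))"
    using rho_inv_dorfman[OF assms(2,3) _ XY, of 1] rho_inv_dorfman[OF assms(2,3) _ XY, of "-1"]
      ec_decompose[of 1 "B X Y"]
    by (simp add: add.commute)
next
  fix c X Y p
  assume c: "adapted_chart A \<eta> K c" and XY: "X \<in> vector_fields A" "Y \<in> vector_fields A" and p: "p \<in> fst c"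
  obtain U \<phi> where c_eq: "c = (U, \<phi>)" by (cases c)
  interpret adapted_coordinates A \<eta> K U \<phi>
    by unfold_locales (use assms(1) c c_eq in auto)
  show "B X Y p =
                 (\<Sum>J\<in>UNIV. tscale
                    ((\<Sum>I\<in>UNIV. coord_components A c X p $ I * partial_deriv c I (\<lambda>q. coord_components A c Y q $ J) p)
                     - (\<Sum>I\<in>UNIV. coord_components A c Y p $ I * partial_deriv c I (\<lambda>q. coord_components A c X q $ J) p)
                     + (\<Sum>I\<in>UNIV. \<Sum>L\<in>UNIV. \<Sum>M\<in>UNIV.
                          metric_matrix A \<eta> c p $ I $ L * matrix_inv (metric_matrix A \<eta> c p) $ M $ J
                          * coord_components A c Y p $ I * partial_deriv c M (\<lambda>q. coord_components A c X q $ L) p))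
                    (coord_vector A c J p))"
    unfolding c_eq using D_bracket_coordinates[OF assms(2,3) XY] p c_eq by simp
qed

end
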